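(* For an element $t=\sum_{i,j,k=1}^n t_{ijk}\,e_i\otimes e_j\otimes e_k$ of the triple tensor product $\ell_1^n\otimes\ell_1^n\otimes\ell_1^n$ (complex scalars), let $$\|t\|_{\min}=\sup\Big\{\Big\|\sum_{ijk}t_{ijk}\,u_i\otimes v_j\otimes w_k\Big\|_{B(H\otimes_2H\otimes_2H)}\Big\},$$ where the supremum runs over all Hilbert spaces $H$ and all unitary operators $u_i,v_j,w_k$ $(1\le i,j,k\le n)$ acting on $H$, and let $$\|t\|_\vee=\sup\Big\{\Big|\sum_{ijk}t_{ijk}\,x_iy_jz_k\Big|\Big\},$$ where the supremum runs over all unimodular complex scalars $x_i,y_j,z_k$. Let $$C_3(n)=\sup\{\|t\|_{\min}\mid \|t\|_\vee\le1\}.$$ Then there is a constant $C'>0$, independent of $n$, such that for all $n\ge2$ $$C_3(n)\ge C'\,n^{1/4}(\log n)^{-3/2}.$$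
   Context: $(e_i)_{1\le i\le n}$ is the canonical basis of $\ell_1^n$; $\otimes_2$ denotes the Hilbert space tensor product, and $B(\cdot)$ the bounded operators with the operator norm. *)

theory Defs
  imports "HOL-Analysis.Analysis" "HOL-Algebra.Module"
begin

text \<open>
  HOL cannot quantify over types inside a formula, so Hilbert spaces are structures on carrier sets,
  and "all Hilbert spaces" means all Hilbert spaces whose underlying set is a subset of a
  type \<open>'a\<close>, which serves as the universe.
\<close>

definition complex_ring :: "complex ring"
  where "complex_ring = \<lparr>carrier = UNIV, mult = (*), one = 1, zero = 0, add = (+)\<rparr>"

text \<open>The fields \<open>mult\<close> and \<open>one\<close> inherited by the HOL-Algebra record for modules play no role.\<close>

record 'a inner_product_space = "(complex, 'a) module" +
  ip :: "'a \<Rightarrow> 'a \<Rightarrow> complex"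

definition hnorm :: "('a, 'm) inner_product_space_scheme \<Rightarrow> 'a \<Rightarrow> real"
  where "hnorm H x = sqrt (Re (ip H x x))"

definition hdist :: "('a, 'm) inner_product_space_scheme \<Rightarrow> 'a \<Rightarrow> 'a \<Rightarrow> real"
  where "hdist H x y = hnorm H (x \<ominus>\<^bsub>H\<^esub> y)"

text \<open>The inner product is linear in its first argument.\<close>

locale hilbert_space = module complex_ring H for H (structure) +
  assumes ip_add_left: "\<lbrakk>x \<in> carrier H; y \<in> carrier H; z \<in> carrier H\<rbrakk>
      \<Longrightarrow> ip H (x \<oplus> y) z = ip H x z + ip H y z"
    and ip_smult_left: "\<lbrakk>x \<in> carrier H; y \<in> carrier H\<rbrakk> \<Longrightarrow> ip H (c \<odot> x) y = c * ip H x y"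
    and ip_cnj: "\<lbrakk>x \<in> carrier H; y \<in> carrier H\<rbrakk> \<Longrightarrow> ip H y x = cnj (ip H x y)"
    and ip_nonneg: "x \<in> carrier H \<Longrightarrow> 0 \<le> Re (ip H x x)"
    and ip_definite: "\<lbrakk>x \<in> carrier H; ip H x x = 0\<rbrakk> \<Longrightarrow> x = \<zero>"
    and complete: "Metric_space.mcomplete (carrier H) (hdist H)"

definition bounded_operator :: "('a, 'm) inner_product_space_scheme \<Rightarrow> ('a \<Rightarrow> 'a) \<Rightarrow> bool"
  where "bounded_operator H T \<longleftrightarrow>
    T \<in> carrier H \<rightarrow> carrier H \<and>
    (\<forall>x\<in>carrier H. \<forall>y\<in>carrier H. T (x \<oplus>\<^bsub>H\<^esub> y) = T x \<oplus>\<^bsub>H\<^esub> T y) \<and>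
    (\<forall>c. \<forall>x\<in>carrier H. T (c \<odot>\<^bsub>H\<^esub> x) = c \<odot>\<^bsub>H\<^esub> T x) \<and>
    (\<exists>B. \<forall>x\<in>carrier H. hnorm H (T x) \<le> B * hnorm H x)"

definition unitary_operator :: "('a, 'm) inner_product_space_scheme \<Rightarrow> ('a \<Rightarrow> 'a) \<Rightarrow> bool"
  where "unitary_operator H u \<longleftrightarrow>
    bounded_operator H u \<and> bij_betw u (carrier H) (carrier H) \<and>
    (\<forall>x\<in>carrier H. \<forall>y\<in>carrier H. ip H (u x) (u y) = ip H x y)"

text \<open>
  Norms and suprema are taken in \<^typ>\<open>ereal\<close>, a complete lattice, so that no boundedness has to be
  established for a supremum to be meaningful.
\<close>

definition operator_norm :: "('a, 'm) inner_product_space_scheme \<Rightarrow> ('a \<Rightarrow> 'a) \<Rightarrow> ereal"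
  where "operator_norm H T = (SUP x\<in>{x \<in> carrier H. hnorm H x \<le> 1}. ereal (hnorm H (T x)))"

text \<open>
  \<open>K\<close> with the trilinear map \<open>\<tau>\<close> (whose value at \<open>x, y, z\<close> is \<open>x \<otimes> y \<otimes> z\<close>) is the Hilbert space
  tensor product of three copies of \<open>H\<close>: the completion of the algebraic tensor product for the
  product inner product. These conditions determine \<open>(K, \<tau>)\<close> up to a unique unitary isomorphism,
  and if \<open>'a\<close> contains \<open>H\<close> and has at least the cardinality of the continuum, such a \<open>K\<close> exists
  with carrier in \<open>'a\<close>, because the Hilbert space tensor product has no more elements than \<open>H\<close>
  when \<open>H \<noteq> 0\<close>.
\<close>

locale hilbert_tensor3 = H: hilbert_space H + K: hilbert_space K
  for H :: "('a, 'm) inner_product_space_scheme"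
    and K :: "('b, 'k) inner_product_space_scheme" +
  fixes \<tau> :: "'a \<Rightarrow> 'a \<Rightarrow> 'a \<Rightarrow> 'b"
  assumes tensor_closed: "\<lbrakk>x \<in> carrier H; y \<in> carrier H; z \<in> carrier H\<rbrakk> \<Longrightarrow> \<tau> x y z \<in> carrier K"
    and tensor_add1: "\<lbrakk>x \<in> carrier H; x' \<in> carrier H; y \<in> carrier H; z \<in> carrier H\<rbrakk>
      \<Longrightarrow> \<tau> (x \<oplus>\<^bsub>H\<^esub> x') y z = \<tau> x y z \<oplus>\<^bsub>K\<^esub> \<tau> x' y z"
    and tensor_add2: "\<lbrakk>x \<in> carrier H; y \<in> carrier H; y' \<in> carrier H; z \<in> carrier H\<rbrakk>
      \<Longrightarrow> \<tau> x (y \<oplus>\<^bsub>H\<^esub> y') z = \<tau> x y z \<oplus>\<^bsub>K\<^esub> \<tau> x y' z"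
    and tensor_add3: "\<lbrakk>x \<in> carrier H; y \<in> carrier H; z \<in> carrier H; z' \<in> carrier H\<rbrakk>
      \<Longrightarrow> \<tau> x y (z \<oplus>\<^bsub>H\<^esub> z') = \<tau> x y z \<oplus>\<^bsub>K\<^esub> \<tau> x y z'"
    and tensor_smult1: "\<lbrakk>x \<in> carrier H; y \<in> carrier H; z \<in> carrier H\<rbrakk>
      \<Longrightarrow> \<tau> (c \<odot>\<^bsub>H\<^esub> x) y z = c \<odot>\<^bsub>K\<^esub> \<tau> x y z"
    and tensor_smult2: "\<lbrakk>x \<in> carrier H; y \<in> carrier H; z \<in> carrier H\<rbrakk>
      \<Longrightarrow> \<tau> x (c \<odot>\<^bsub>H\<^esub> y) z = c \<odot>\<^bsub>K\<^esub> \<tau> x y z"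
    and tensor_smult3: "\<lbrakk>x \<in> carrier H; y \<in> carrier H; z \<in> carrier H\<rbrakk>
      \<Longrightarrow> \<tau> x y (c \<odot>\<^bsub>H\<^esub> z) = c \<odot>\<^bsub>K\<^esub> \<tau> x y z"
    and tensor_ip: "\<lbrakk>x \<in> carrier H; y \<in> carrier H; z \<in> carrier H;
        x' \<in> carrier H; y' \<in> carrier H; z' \<in> carrier H\<rbrakk>
      \<Longrightarrow> ip K (\<tau> x y z) (\<tau> x' y' z') = ip H x x' * ip H y y' * ip H z z'"
    and tensor_dense: "\<lbrakk>\<xi> \<in> carrier K; 0 < \<epsilon>\<rbrakk>
      \<Longrightarrow> \<exists>(N::nat) x y z. x \<in> {..<N} \<rightarrow> carrier H \<and> y \<in> {..<N} \<rightarrow> carrier H \<and> z \<in> {..<N} \<rightarrow> carrier H \<and>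
            hdist K \<xi> (\<Oplus>\<^bsub>K\<^esub>l\<in>{..<N}. \<tau> (x l) (y l) (z l)) < \<epsilon>"

text \<open>\<open>W = u \<otimes> v \<otimes> w\<close>; such a \<open>W\<close> is unique on the carrier of \<open>K\<close>.\<close>

definition is_tensor_operator ::
  "('a, 'm) inner_product_space_scheme \<Rightarrow> ('b, 'k) inner_product_space_scheme \<Rightarrow>
    ('a \<Rightarrow> 'a \<Rightarrow> 'a \<Rightarrow> 'b) \<Rightarrow> ('a \<Rightarrow> 'a) \<Rightarrow> ('a \<Rightarrow> 'a) \<Rightarrow> ('a \<Rightarrow> 'a) \<Rightarrow> ('b \<Rightarrow> 'b) \<Rightarrow> bool"
  where "is_tensor_operator H K \<tau> u v w W \<longleftrightarrow>
    bounded_operator K W \<and>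
    (\<forall>x\<in>carrier H. \<forall>y\<in>carrier H. \<forall>z\<in>carrier H. W (\<tau> x y z) = \<tau> (u x) (v y) (w z))"

text \<open>
  A tensor \<open>\<Sum>\<^sub>i\<^sub>j\<^sub>k t\<^sub>i\<^sub>j\<^sub>k e\<^sub>i \<otimes> e\<^sub>j \<otimes> e\<^sub>k\<close> is given by its coefficients; only indices in \<open>{1..n}\<close> matter.
\<close>

type_synonym coeffs3 = "nat \<Rightarrow> nat \<Rightarrow> nat \<Rightarrow> complex"

definition min_norm :: "'a itself \<Rightarrow> nat \<Rightarrow> coeffs3 \<Rightarrow> ereal"
  where "min_norm (_ :: 'a itself) n t = Sup
    {operator_norm K (\<lambda>\<xi>. \<Oplus>\<^bsub>K\<^esub>i\<in>{1..n}. \<Oplus>\<^bsub>K\<^esub>j\<in>{1..n}. \<Oplus>\<^bsub>K\<^esub>k\<in>{1..n}. t i j k \<odot>\<^bsub>K\<^esub> W i j k \<xi>)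
      | (H :: 'a inner_product_space) (K :: 'a inner_product_space) \<tau> u v w W.
        hilbert_space H \<and> hilbert_tensor3 H K \<tau> \<and>
        (\<forall>i\<in>{1..n}. unitary_operator H (u i)) \<and>
        (\<forall>j\<in>{1..n}. unitary_operator H (v j)) \<and>
        (\<forall>k\<in>{1..n}. unitary_operator H (w k)) \<and>
        (\<forall>i\<in>{1..n}. \<forall>j\<in>{1..n}. \<forall>k\<in>{1..n}.
          is_tensor_operator H K \<tau> (u i) (v j) (w k) (W i j k))}"

definition vee_norm :: "nat \<Rightarrow> coeffs3 \<Rightarrow> ereal"
  where "vee_norm n t = Sup
    {ereal (cmod (\<Sum>i=1..n. \<Sum>j=1..n. \<Sum>k=1..n. t i j k * x i * y j * z k))
      | x y z. (\<forall>i\<in>{1..n}. cmod (x i) = 1) \<and> (\<forall>j\<in>{1..n}. cmod (y j) = 1) \<and>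
        (\<forall>k\<in>{1..n}. cmod (z k) = 1)}"

definition C3 :: "'a itself \<Rightarrow> nat \<Rightarrow> ereal"
  where "C3 U n = Sup {min_norm U n t | t. vee_norm n t \<le> 1}"

end

(*
  With N ~ sqrt n, the N^2 Weyl matrices V_i form an orthogonal basis of the N x N matrices
  consisting of unitaries. For sign tensors psi, phi on {0..<N}^3 put
  t_ijk = <psi, (V_i (x) V_j (x) V_k) phi>. Evaluating at the complex
  conjugates of the V_i gives ||t||_min >= sum |t_ijk|^2 / (|psi| |phi|) = N^6 by Parseval. For
  unimodular scalars a_i, A = sum a_i V_i has Hilbert-Schmidt norm N^(3/2), so ||t||_vee is at most
  N^(9/2) times the supremum of |<psi, (A (x) B (x) C) phi>| over the Hilbert-Schmidt unit balls.

  The point is that random signs make this supremum O(N log N). First choose phi with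
  |phi(a,b,c)| <= const sqrt N |a| |b| |c|. Then |(A (x) B (x) C) phi| is at most const sqrt N times
  the operator norm of one factor and the Hilbert-Schmidt norms of the other two, and so the
  random variable <psi, (A (x) B (x) C) phi>, for random psi, has subgaussian increments with respect
  to the operator norm. At scale 2^-k the Hilbert-Schmidt ball has an operator norm net of
  cardinality exp (O(N 4^k)): matrices of rank 4^k, found greedily. Each of the O(log N)
  scales of a chaining argument therefore contributes O(N).
*)

theory Submission
  imports Defs
begin

text \<open>The bounds give the quotient
  \<open>N ^ 6 / (N powr (9/2) * N * log N) = sqrt N / log N\<close>, that is, n^(1/4) / log n; the
  claimed power -3/2 of the logarithm is weaker still. The obstacle is the dimension
  \<open>N ^ 2\<close> of the matrix space. A union bound over a single net of the Hilbert-Schmidt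
  ball, of cardinality exp (O(N^2)), against vectors of norm O(sqrt N) would give N^(3/2) for the
  supremum, and the quotient would be constant. Low rank nets avoid this: deviations of order sqrt N
  * 2^k meet increments of order sqrt N * 2^-k, and the product is N at every scale. The chain may
  stop once 2^k reaches N, because there Cauchy-Schwarz against the norm N^(3/2) of
  \<open>\<psi>\<close> already gives O(N). The signs are chosen in two rounds so that, with
  \<open>\<phi>\<close> fixed, the form is linear in \<open>\<psi>\<close>: subgaussian tails
  suffice and no second order chaos has to be estimated. Probability is counting of sign patterns.
  All random estimates concern real matrices; complex ones cost a factor 8. The Hilbert spaces are
  copies of C^N and C^(N^3), both placed in the universe by one injection of complex
  sequences.\<close>

section \<open>Random signs\<close>

text \<open>Term by term in the power series of \<open>cosh x\<close> and
  \<open>exp (x\<^sup>2 / 2)\<close> this is \<open>2 ^ n * fact n \<le> fact (2 * n)\<close>. It is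
  the subgaussian moment bound for one random sign.\<close>

lemma exp_plus_exp_minus_le:
  fixes x :: real
  shows "exp x + exp (- x) \<le> 2 * exp (x\<^sup>2 / 2)"
proof -
  have "(\<lambda>n. (if even n then inverse (fact n) * x ^ n else 0)) sums cosh x"
    using cosh_converges[of x] by (simp only: real_scaleR_def)
  then have "(\<lambda>n. (if even (2*n) then inverse (fact (2*n)) * x ^ (2*n) else 0)) sums cosh x"
    by (subst sums_mono_reindex) (auto simp: strict_mono_def elim!: evenE)
  then have c: "(\<lambda>n. inverse (fact (2*n)) * x ^ (2*n)) sums cosh x"
    by simp
  have e: "(\<lambda>n. inverse (fact n) * (x\<^sup>2 / 2) ^ n) sums exp (x\<^sup>2 / 2)"
    using exp_converges[of "x\<^sup>2 / 2"] by (simp only: real_scaleR_def)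
  have "cosh x \<le> exp (x\<^sup>2 / 2)"
  proof (rule sums_le[OF _ c e])
    fix n :: nat
    have "2 ^ n * fact n \<le> (fact (2*n) :: real)"
    proof (induction n)
      case (Suc n)
      have "2 ^ Suc n * fact (Suc n) = (2 * real (Suc n)) * (2 ^ n * fact n)"
        by (simp add: algebra_simps)
      also have "\<dots> \<le> (2 * real (Suc n)) * (real (2 * n + 1) * fact (2*n))"
      proof (rule mult_left_mono)
        have "1 * (2 ^ n * fact n :: real) \<le> real (2 * n + 1) * fact (2*n)"
          using Suc by (intro mult_mono) auto
        then show "2 ^ n * fact n \<le> real (2 * n + 1) * fact (2*n)" by simp
      qed simp
      also have "\<dots> = fact (2 * Suc n)"
        by (simp add: algebra_simps)
      finally show ?case .
    qed simp
    then have "inverse (fact (2*n)) \<le> inverse (2 ^ n * fact n :: real)"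
      by (intro le_imp_inverse_le) auto
    then have "inverse (fact (2*n)) * (x\<^sup>2) ^ n \<le> inverse (2 ^ n * fact n) * (x\<^sup>2) ^ n"
      by (intro mult_right_mono) auto
    then show "inverse (fact (2*n)) * x ^ (2*n) \<le> inverse (fact n) * (x\<^sup>2 / 2) ^ n"
      by (simp add: power_mult power_divide field_simps power2_eq_square power_mult_distrib)
  qed
  then show ?thesis
    by (simp add: cosh_def)
qed

text \<open>Chernoff and union bound by counting: if every sign pattern violated some constraint, an
  exponential majorant summed over \<open>M\<close> would be at least 1 at every pattern, while its
  average over all patterns is at most the left side of \<open>union_bound\<close>.\<close>

lemma signs_exist:
  fixes \<theta> :: "'m \<Rightarrow> 'i \<Rightarrow> real" and s :: "'m \<Rightarrow> real"
  assumes I: "finite I" and M: "finite M" and s: "\<And>m. m \<in> M \<Longrightarrow> 0 \<le> s m"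
    and union_bound: "(\<Sum>m\<in>M. 2 * exp (- (s m)\<^sup>2 / 2)) < 1"
  shows "\<exists>\<epsilon> :: 'i \<Rightarrow> real. (\<forall>i\<in>I. \<bar>\<epsilon> i\<bar> = 1) \<and>
    (\<forall>m\<in>M. \<bar>\<Sum>i\<in>I. \<epsilon> i * \<theta> m i\<bar> \<le> s m * L2_set (\<theta> m) I)"
proof (rule ccontr)
  assume contra: "\<not> ?thesis"
  define \<Omega> where "\<Omega> = PiE I (\<lambda>_. {-1, 1 :: real})"
  have fin: "finite \<Omega>" unfolding \<Omega>_def by (intro finite_PiE I) auto
  have card: "real (card \<Omega>) = 2 ^ card I" unfolding \<Omega>_def by (simp add: card_PiE I)
  have mgf: "(\<Sum>\<epsilon>\<in>\<Omega>. exp (c * (\<Sum>i\<in>I. \<epsilon> i * \<theta> m i))) \<le> 2 ^ card I * exp (c\<^sup>2 * (L2_set (\<theta> m) I)\<^sup>2 / 2)"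
    for c m
  proof -
    have "(\<Sum>\<epsilon>\<in>\<Omega>. exp (c * (\<Sum>i\<in>I. \<epsilon> i * \<theta> m i)))
        = (\<Sum>\<epsilon>\<in>\<Omega>. \<Prod>i\<in>I. exp (c * \<epsilon> i * \<theta> m i))"
      by (simp add: sum_distrib_left exp_sum I mult.assoc)
    also have "\<dots> = (\<Prod>i\<in>I. \<Sum>e\<in>{-1, 1}. exp (c * e * \<theta> m i))"
      unfolding \<Omega>_def by (rule prod_sum_PiE[symmetric]) (auto simp: I)
    also have "\<dots> \<le> (\<Prod>i\<in>I. 2 * exp ((c * \<theta> m i)\<^sup>2 / 2))"
      using exp_plus_exp_minus_le[of "c * \<theta> m i" for i]
      by (intro prod_mono) (auto intro: add_nonneg_nonneg simp: add.commute)
    also have "\<dots> = 2 ^ card I * exp (\<Sum>i\<in>I. (c * \<theta> m i)\<^sup>2 / 2)"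
      by (simp add: prod.distrib exp_sum I)
    also have "(\<Sum>i\<in>I. (c * \<theta> m i)\<^sup>2 / 2) = c\<^sup>2 * (L2_set (\<theta> m) I)\<^sup>2 / 2"
      by (simp add: L2_set_def sum_nonneg power_mult_distrib sum_distrib_left sum_divide_distrib)
    finally show ?thesis .
  qed
  \<comment> \<open>\<open>c m\<close> is the optimal Chernoff parameter; if the norm vanishes it is
    0, by the convention for division by zero, and the moment estimate survives this case. The two
    exponentials in \<open>G\<close> cover violations of either sign.\<close>
  define c where "c m = s m / L2_set (\<theta> m) I" for m
  define G where "G \<epsilon> m = (exp (c m * (\<Sum>i\<in>I. \<epsilon> i * \<theta> m i)) + exp (- c m * (\<Sum>i\<in>I. \<epsilon> i * \<theta> m i)))
     * exp (- (s m)\<^sup>2)" for \<epsilon> m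
  have G_nonneg: "0 \<le> G \<epsilon> m" for \<epsilon> m
    unfolding G_def by (intro mult_nonneg_nonneg add_nonneg_nonneg) auto
  have "1 \<le> (\<Sum>m\<in>M. G \<epsilon> m)" if "\<epsilon> \<in> \<Omega>" for \<epsilon>
  proof -
    have "\<forall>i\<in>I. \<bar>\<epsilon> i\<bar> = 1" using that unfolding \<Omega>_def by (auto simp: PiE_iff)
    with contra obtain m where m: "m \<in> M" and big: "\<bar>\<Sum>i\<in>I. \<epsilon> i * \<theta> m i\<bar> > s m * L2_set (\<theta> m) I"
      by (auto simp: not_le)
    have L: "L2_set (\<theta> m) I > 0"
    proof (rule ccontr)
      assume "\<not> L2_set (\<theta> m) I > 0"
      then have z: "L2_set (\<theta> m) I = 0" using L2_set_nonneg[of "\<theta> m" I] by linarith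
      then have "\<forall>i\<in>I. \<theta> m i = 0" using L2_set_eq_0_iff[OF I] by blast
      then show False using big z by simp
    qed
    let ?S = "\<Sum>i\<in>I. \<epsilon> i * \<theta> m i"
    have "(s m)\<^sup>2 = c m * (s m * L2_set (\<theta> m) I)"
      unfolding c_def using L by (simp add: power2_eq_square)
    also have "\<dots> \<le> c m * \<bar>?S\<bar>"
      using big s[OF m] L unfolding c_def by (intro mult_left_mono) auto
    finally have *: "(s m)\<^sup>2 \<le> c m * \<bar>?S\<bar>" .
    have "exp ((s m)\<^sup>2) \<le> exp (c m * ?S) + exp (- c m * ?S)"
    proof (cases "?S \<ge> 0")
      case True
      then have "exp ((s m)\<^sup>2) \<le> exp (c m * ?S)" using * by simp
      then show ?thesis using exp_gt_zero[of "- c m * ?S"] by linarith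
    next
      case False
      then have "exp ((s m)\<^sup>2) \<le> exp (- c m * ?S)" using * by simp
      then show ?thesis using exp_gt_zero[of "c m * ?S"] by linarith
    qed
    then have "exp ((s m)\<^sup>2) * exp (- (s m)\<^sup>2) \<le> G \<epsilon> m"
      unfolding G_def by (intro mult_right_mono) auto
    then have "1 \<le> G \<epsilon> m" by (simp flip: exp_add)
    also have "\<dots> \<le> (\<Sum>m\<in>M. G \<epsilon> m)"
      using G_nonneg M m by (intro member_le_sum) auto
    finally show ?thesis .
  qed
  then have "(\<Sum>\<epsilon>\<in>\<Omega>. 1) \<le> (\<Sum>\<epsilon>\<in>\<Omega>. \<Sum>m\<in>M. G \<epsilon> m)"
    by (intro sum_mono)
  also have "\<dots> = (\<Sum>m\<in>M. \<Sum>\<epsilon>\<in>\<Omega>. G \<epsilon> m)"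
    by (rule sum.swap)
  also have "\<dots> \<le> (\<Sum>m\<in>M. 2 ^ card I * (2 * exp (- (s m)\<^sup>2 / 2)))"
  proof (rule sum_mono)
    fix m assume m: "m \<in> M"
    have cs: "(c m)\<^sup>2 * (L2_set (\<theta> m) I)\<^sup>2 \<le> (s m)\<^sup>2"
      unfolding c_def by (cases "L2_set (\<theta> m) I = 0") (auto simp: power_divide)
    have "(\<Sum>\<epsilon>\<in>\<Omega>. G \<epsilon> m) = ((\<Sum>\<epsilon>\<in>\<Omega>. exp (c m * (\<Sum>i\<in>I. \<epsilon> i * \<theta> m i)))
        + (\<Sum>\<epsilon>\<in>\<Omega>. exp (- c m * (\<Sum>i\<in>I. \<epsilon> i * \<theta> m i)))) * exp (- (s m)\<^sup>2)"
      unfolding G_def by (simp add: sum.distrib flip: sum_distrib_right)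
    also have "\<dots> \<le> (2 ^ card I * exp ((s m)\<^sup>2 / 2) + 2 ^ card I * exp ((s m)\<^sup>2 / 2)) * exp (- (s m)\<^sup>2)"
    proof (intro mult_right_mono add_mono)
      have *: "2 ^ card I * exp ((c m)\<^sup>2 * (L2_set (\<theta> m) I)\<^sup>2 / 2) \<le> 2 ^ card I * exp ((s m)\<^sup>2 / 2)"
        using cs by simp
      show "(\<Sum>\<epsilon>\<in>\<Omega>. exp (c m * (\<Sum>i\<in>I. \<epsilon> i * \<theta> m i))) \<le> 2 ^ card I * exp ((s m)\<^sup>2 / 2)"
        using mgf[of "c m" m] * by linarith
      show "(\<Sum>\<epsilon>\<in>\<Omega>. exp (- c m * (\<Sum>i\<in>I. \<epsilon> i * \<theta> m i))) \<le> 2 ^ card I * exp ((s m)\<^sup>2 / 2)"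
        using mgf[of "- c m" m] * unfolding power2_minus by linarith
    qed simp
    also have "\<dots> = 2 ^ card I * (2 * (exp ((s m)\<^sup>2 / 2) * exp (- (s m)\<^sup>2)))"
      by simp
    also have "exp ((s m)\<^sup>2 / 2) * exp (- (s m)\<^sup>2) = exp (- (s m)\<^sup>2 / 2)"
      by (simp flip: exp_add)
    finally show "(\<Sum>\<epsilon>\<in>\<Omega>. G \<epsilon> m) \<le> 2 ^ card I * (2 * exp (- (s m)\<^sup>2 / 2))" .
  qed
  also have "\<dots> = 2 ^ card I * (\<Sum>m\<in>M. 2 * exp (- (s m)\<^sup>2 / 2))"
    by (simp add: sum_distrib_left)
  also have "\<dots> < 2 ^ card I * 1"
    using union_bound by (intro mult_strict_left_mono) auto
  finally show False using card by simp
qed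

section \<open>Finite testing of Euclidean norms\<close>

text \<open>Rounding dictates the radius: a vector of norm \<open>sqrt N\<close>, moved by at most 1
  in each coordinate, has squared norm at most \<open>2 * N + 2 * N\<close>. After division by
  \<open>sqrt N\<close> the test vectors have norm at most 2.\<close>

definition lattice_ball :: "nat \<Rightarrow> (nat \<Rightarrow> int) set"
  where "lattice_ball N = {w. (\<forall>i\<ge>N. w i = 0) \<and> (\<Sum>i<N. (w i)\<^sup>2) \<le> 4 * int N}"

definition test_vectors :: "nat \<Rightarrow> (nat \<Rightarrow> real) set"
  where "test_vectors N = (\<lambda>w i. of_int (w i) / sqrt (real N)) ` lattice_ball N"

lemma sum_half_power_abs: "(\<Sum>z\<in>{- int M..int M}. (1/2 :: real) ^ nat \<bar>z\<bar>) \<le> 3"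
proof -
  have "(\<Sum>z\<in>{- int M..int M}. (1/2 :: real) ^ nat \<bar>z\<bar>) = 3 - 2 * (1/2) ^ M"
  proof (induction M)
    case (Suc M)
    have "{- int (Suc M)..int (Suc M)} = insert (int (Suc M)) (insert (- int (Suc M)) {- int M..int M})"
      by auto
    then show ?case using Suc by (simp add: nat_add_distrib)
  qed simp
  then show ?thesis by simp
qed

text \<open>The weight \<open>2 ^ (4N - \<parallel>w\<parallel>\<^sub>1)\<close> is at least \<open>1\<close> on the ball and factorises over the coordinates.\<close>

lemma finite_lattice_ball: "finite (lattice_ball N)"
  and card_lattice_ball: "card (lattice_ball N) \<le> 48 ^ N"
proof -
  define M where "M = 4 * N"
  define P where "P = PiE {..<N} (\<lambda>_. {- int M..int M})"
  define W where "W = {w \<in> P. (\<Sum>i<N. \<bar>w i\<bar>) \<le> int M}"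
  let ?r = "\<lambda>w :: nat \<Rightarrow> int. restrict w {..<N}"
  have inj: "inj_on ?r (lattice_ball N)"
  proof (rule inj_onI)
    fix w w' assume w: "w \<in> lattice_ball N" "w' \<in> lattice_ball N" and eq: "?r w = ?r w'"
    show "w = w'"
    proof
      fix i show "w i = w' i"
        using w fun_cong[OF eq, of i] by (cases "i < N") (auto simp: lattice_ball_def)
    qed
  qed
  have sub: "?r ` lattice_ball N \<subseteq> W"
  proof (rule image_subsetI)
    fix w assume w: "w \<in> lattice_ball N"
    have abs_le: "\<bar>z\<bar> \<le> z\<^sup>2" for z :: int
      using mult_left_mono[of 1 "\<bar>z\<bar>" "\<bar>z\<bar>"] by (cases "z = 0") (auto simp: power2_eq_square abs_mult_self_eq)
    have "(\<Sum>i<N. \<bar>w i\<bar>) \<le> (\<Sum>i<N. (w i)\<^sup>2)"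
      by (intro sum_mono abs_le)
    also have "\<dots> \<le> int M" using w by (simp add: lattice_ball_def M_def)
    finally have s: "(\<Sum>i<N. \<bar>w i\<bar>) \<le> int M" .
    have "\<bar>w i\<bar> \<le> int M" if "i < N" for i
      using member_le_sum[of i "{..<N}" "\<lambda>i. \<bar>w i\<bar>"] s that by simp
    then have "\<forall>i<N. w i \<in> {- int M..int M}" by (fastforce simp: abs_le_iff)
    then show "?r w \<in> W" using s by (auto simp: W_def P_def)
  qed
  have finP: "finite P" unfolding P_def by (intro finite_PiE) auto
  then have finW: "finite W" by (simp add: W_def)
  show "finite (lattice_ball N)"
    using finite_subset[OF sub finW] inj by (rule finite_imageD)
  have "card (lattice_ball N) = card (?r ` lattice_ball N)"
    using inj by (simp add: card_image)
  also have "\<dots> \<le> card W" by (intro card_mono finW sub)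
  finally have "real (card (lattice_ball N)) \<le> (\<Sum>w\<in>W. 1)" by simp
  also have "\<dots> \<le> (\<Sum>w\<in>W. 2 ^ M * (\<Prod>i<N. (1/2) ^ nat \<bar>w i\<bar>))"
  proof (rule sum_mono)
    fix w assume "w \<in> W"
    then have "int (\<Sum>i<N. nat \<bar>w i\<bar>) = (\<Sum>i<N. \<bar>w i\<bar>)" unfolding of_nat_sum by (intro sum.cong) auto
    also have "\<dots> \<le> int M" using \<open>w \<in> W\<close> by (simp add: W_def)
    finally have "(\<Sum>i<N. nat \<bar>w i\<bar>) \<le> M" by (simp only: of_nat_le_iff)
    then have "(1/2 :: real) ^ M \<le> (1/2) ^ (\<Sum>i<N. nat \<bar>w i\<bar>)"
      by (rule power_decreasing) auto
    then have "2 ^ M * (1/2) ^ M \<le> 2 ^ M * (1/2 :: real) ^ (\<Sum>i<N. nat \<bar>w i\<bar>)"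
      by (intro mult_left_mono) auto
    then show "1 \<le> 2 ^ M * (\<Prod>i<N. (1/2 :: real) ^ nat \<bar>w i\<bar>)"
      by (simp add: power_sum flip: power_mult_distrib)
  qed
  also have "\<dots> \<le> (\<Sum>w\<in>P. 2 ^ M * (\<Prod>i<N. (1/2) ^ nat \<bar>w i\<bar>))"
    by (intro sum_mono2 finP) (auto simp: W_def intro!: mult_nonneg_nonneg prod_nonneg)
  also have "\<dots> = 2 ^ M * (\<Prod>i<N. \<Sum>z\<in>{- int M..int M}. (1/2) ^ nat \<bar>z\<bar>)"
    unfolding P_def by (subst prod_sum_PiE) (auto simp: sum_distrib_left)
  also have "\<dots> \<le> 2 ^ M * (\<Prod>i<N. 3)"
    by (intro mult_left_mono prod_mono conjI sum_half_power_abs sum_nonneg) auto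
  \<comment> \<open>\<open>48 = 2 ^ 4 * 3\<close>: per coordinate the weight contributes
    \<open>2 ^ 4\<close>, and the powers of 1/2 summed over the integers contribute at most
    3.\<close>
  also have "\<dots> = real (48 ^ N)"
    by (simp add: M_def power_mult flip: power_mult_distrib)
  finally show "card (lattice_ball N) \<le> 48 ^ N" by linarith
qed

lemma finite_test_vectors: "finite (test_vectors N)"
  and card_test_vectors: "card (test_vectors N) \<le> 48 ^ N"
  using finite_lattice_ball card_lattice_ball[of N]
    card_image_le[OF finite_lattice_ball, of "\<lambda>w i. of_int (w i) / sqrt (real N)" N]
  by (auto simp: test_vectors_def)

lemma zero_test_vectors: "(\<lambda>_. 0) \<in> test_vectors N"
  unfolding test_vectors_def by (rule image_eqI[of _ _ "\<lambda>_. 0"]) (auto simp: lattice_ball_def)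

lemma L2_set_test_vectors:
  assumes "z \<in> test_vectors N"
  shows "L2_set z {..<N} \<le> 2"
proof (cases "N = 0")
  case False
  from assms obtain w where w: "w \<in> lattice_ball N" and z: "z = (\<lambda>i. of_int (w i) / sqrt (real N))"
    by (auto simp: test_vectors_def)
  have "(\<Sum>i<N. (z i)\<^sup>2) = real_of_int (\<Sum>i<N. (w i)\<^sup>2) / real N"
    by (simp add: z power_divide sum_divide_distrib)
  also have "\<dots> \<le> real_of_int (4 * int N) / real N"
    using w by (intro divide_right_mono, subst of_int_le_iff) (auto simp: lattice_ball_def)
  also have "\<dots> = 4" using False by simp
  finally have "sqrt (\<Sum>i<N. (z i)\<^sup>2) \<le> sqrt 4" by (rule real_sqrt_le_mono)
  then show ?thesis by (simp add: L2_set_def)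
qed simp

text \<open>Rounding every coordinate of \<open>sqrt N * x\<close> to an integer in the direction of the sign of
  \<open>l\<close> does not decrease \<open>l\<close>; so testing \<open>l\<close> on the finite set loses nothing against the unit ball.\<close>

lemma L2_set_le_test:
  assumes test: "\<And>z. z \<in> test_vectors N \<Longrightarrow> (\<Sum>i<N. l i * z i) \<le> t"
  shows "L2_set l {..<N} \<le> t"
proof (cases "L2_set l {..<N} = 0")
  case True
  then show ?thesis using test[OF zero_test_vectors] by simp
next
  case False
  define L where "L = L2_set l {..<N}"
  have L: "L > 0" using False L2_set_nonneg[of l "{..<N}"] unfolding L_def by linarith
  have L2: "(\<Sum>i<N. (l i)\<^sup>2) = L\<^sup>2"
    unfolding L_def L2_set_def by (simp add: sum_nonneg)
  have N: "N > 0" using False by (cases N) auto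
  define y where "y i = sqrt (real N) * (l i / L)" for i
  define w where "w i = (if i < N then if l i \<ge> 0 then \<lceil>y i\<rceil> else \<lfloor>y i\<rfloor> else 0)" for i
  have "(\<Sum>i<N. (w i)\<^sup>2) \<le> 4 * int N"
  proof -
    have "(\<Sum>i<N. (real_of_int (w i))\<^sup>2) \<le> (\<Sum>i<N. 2 * (y i)\<^sup>2 + 2)"
    proof (rule sum_mono)
      fix i assume "i \<in> {..<N}"
      have "\<bar>real_of_int (w i)\<bar> \<le> \<bar>y i\<bar> + 1" unfolding w_def by (auto; linarith)
      then have "(real_of_int (w i))\<^sup>2 \<le> (\<bar>y i\<bar> + 1)\<^sup>2"
        using power_mono[of "\<bar>real_of_int (w i)\<bar>" "\<bar>y i\<bar> + 1" 2] by simp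
      also have "\<dots> \<le> 2 * (y i)\<^sup>2 + 2"
        using sum_squares_ge_zero[of "\<bar>y i\<bar> - 1" 0] by (simp add: power2_eq_square algebra_simps)
      finally show "(real_of_int (w i))\<^sup>2 \<le> 2 * (y i)\<^sup>2 + 2" .
    qed
    also have "\<dots> = 2 * (real N / L\<^sup>2) * (\<Sum>i<N. (l i)\<^sup>2) + 2 * real N"
      by (simp add: y_def sum.distrib power_mult_distrib power_divide sum_distrib_left sum_divide_distrib mult.assoc)
    also have "\<dots> = 4 * real N" using L by (simp add: L2)
    finally have "real_of_int (\<Sum>i<N. (w i)\<^sup>2) \<le> real_of_int (4 * int N)" by simp
    then show ?thesis by (subst (asm) of_int_le_iff)
  qed
  then have "w \<in> lattice_ball N" by (simp add: lattice_ball_def w_def)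
  then have mem: "(\<lambda>i. of_int (w i) / sqrt (real N)) \<in> test_vectors N" by (simp add: test_vectors_def)
  have "L = (\<Sum>i<N. l i * (y i / sqrt (real N)))"
    using L N by (simp add: y_def power2_eq_square L2[unfolded power2_eq_square] flip: sum_divide_distrib)
  also have "\<dots> \<le> (\<Sum>i<N. l i * (of_int (w i) / sqrt (real N)))"
  proof (rule sum_mono)
    fix i assume i: "i \<in> {..<N}"
    have "l i * y i \<le> l i * of_int (w i)"
    proof (cases "l i \<ge> 0")
      case True
      then show ?thesis using i by (intro mult_left_mono) (auto simp: w_def)
    next
      case False
      then show ?thesis using i by (intro mult_left_mono_neg) (auto simp: w_def)
    qed
    then show "l i * (y i / sqrt (real N)) \<le> l i * (of_int (w i) / sqrt (real N))"
      using N by (simp add: divide_right_mono)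
  qed
  also have "\<dots> \<le> t" by (rule test[OF mem])
  finally show ?thesis by (simp add: L_def)
qed

section \<open>Cauchy-Schwarz, Hilbert-Schmidt norms and operator norm bounds\<close>

lemma sum_mult_le_L2_set: "(\<Sum>i\<in>I. f i * g i) \<le> L2_set f I * L2_set g I" for f g :: "'i \<Rightarrow> real"
proof -
  have "(\<Sum>i\<in>I. f i * g i) \<le> (\<Sum>i\<in>I. \<bar>f i\<bar> * \<bar>g i\<bar>)"
    by (intro sum_mono) (simp flip: abs_mult)
  also have "\<dots> \<le> L2_set f I * L2_set g I" by (rule L2_set_mult_ineq)
  finally show ?thesis .
qed

lemma sum_self_mult_eq_L2_set: "(\<Sum>i\<in>I. f i * f i) = (L2_set f I)\<^sup>2" for f :: "'i \<Rightarrow> real"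
  by (simp add: L2_set_def sum_nonneg flip: power2_eq_square)

lemma abs_sum_mult_le_L2_set: "\<bar>\<Sum>i\<in>I. f i * g i\<bar> \<le> L2_set f I * L2_set g I" for f g :: "'i \<Rightarrow> real"
proof -
  have "\<bar>\<Sum>i\<in>I. f i * g i\<bar> \<le> (\<Sum>i\<in>I. \<bar>f i\<bar> * \<bar>g i\<bar>)"
    using sum_abs[of "\<lambda>i. f i * g i" I] by (simp add: abs_mult)
  also have "\<dots> \<le> L2_set f I * L2_set g I" by (rule L2_set_mult_ineq)
  finally show ?thesis .
qed

definition hs_norm :: "nat \<Rightarrow> (nat \<Rightarrow> nat \<Rightarrow> real) \<Rightarrow> real"
  where "hs_norm N A = L2_set (\<lambda>(i, j). A i j) ({..<N} \<times> {..<N})"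

definition op_le :: "nat \<Rightarrow> (nat \<Rightarrow> nat \<Rightarrow> real) \<Rightarrow> real \<Rightarrow> bool"
  where "op_le N A t \<longleftrightarrow> (\<forall>x. L2_set (\<lambda>i. \<Sum>j<N. A i j * x j) {..<N} \<le> t * L2_set x {..<N})"

text \<open>The vectors are tested one side at a time. For a test vector on the left, testing the
  right side bounds the norm of the resulting functional; hence the right vector may be arbitrary
  when the left side is tested. No constant is lost in either round.\<close>

lemma op_le_test:
  assumes test: "\<And>z z'. z \<in> test_vectors N \<Longrightarrow> z' \<in> test_vectors N \<Longrightarrow> (\<Sum>i<N. \<Sum>j<N. R i j * z i * z' j) \<le> t"
  shows "op_le N R t"
  unfolding op_le_def
proof
  fix x
  have row: "L2_set (\<lambda>j. \<Sum>i<N. R i j * z i) {..<N} \<le> t" if z: "z \<in> test_vectors N" for z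
  proof (rule L2_set_le_test)
    fix z' assume "z' \<in> test_vectors N"
    then have "(\<Sum>i<N. \<Sum>j<N. R i j * z i * z' j) \<le> t" by (rule test[OF z])
    then show "(\<Sum>j<N. (\<Sum>i<N. R i j * z i) * z' j) \<le> t"
      unfolding sum_distrib_right by (subst sum.swap)
  qed
  show "L2_set (\<lambda>i. \<Sum>j<N. R i j * x j) {..<N} \<le> t * L2_set x {..<N}"
  proof (rule L2_set_le_test)
    fix z assume z: "z \<in> test_vectors N"
    have "(\<Sum>i<N. (\<Sum>j<N. R i j * x j) * z i) = (\<Sum>j<N. (\<Sum>i<N. R i j * z i) * x j)"
      unfolding sum_distrib_right by (subst sum.swap) (simp add: mult_ac)
    also have "\<dots> \<le> L2_set (\<lambda>j. \<Sum>i<N. R i j * z i) {..<N} * L2_set x {..<N}"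
      by (rule sum_mult_le_L2_set)
    also have "\<dots> \<le> t * L2_set x {..<N}" by (intro mult_right_mono row z L2_set_nonneg)
    finally show "(\<Sum>i<N. (\<Sum>j<N. R i j * x j) * z i) \<le> t * L2_set x {..<N}" .
  qed
qed

section \<open>Tensor products of matrices\<close>

lemma sum_rotate3: "(\<Sum>i\<in>A. \<Sum>j\<in>B. \<Sum>k\<in>C. f i j k) = (\<Sum>k\<in>C. \<Sum>i\<in>A. \<Sum>j\<in>B. f i j k)"
proof -
  have "(\<Sum>i\<in>A. \<Sum>j\<in>B. \<Sum>k\<in>C. f i j k) = (\<Sum>i\<in>A. \<Sum>k\<in>C. \<Sum>j\<in>B. f i j k)"
    by (intro sum.cong refl sum.swap)
  also have "\<dots> = (\<Sum>k\<in>C. \<Sum>i\<in>A. \<Sum>j\<in>B. f i j k)" by (rule sum.swap)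
  finally show ?thesis .
qed

definition cube :: "nat \<Rightarrow> (nat \<times> nat \<times> nat) set"
  where "cube N = {..<N} \<times> {..<N} \<times> {..<N}"

lemma finite_cube [simp]: "finite (cube N)" and card_cube: "card (cube N) = N ^ 3"
  by (auto simp: cube_def power3_eq_cube)

lemma sum_cube: "(\<Sum>p\<in>cube N. f p) = (\<Sum>i<N. \<Sum>j<N. \<Sum>k<N. f (i, j, k))"
  unfolding cube_def by (simp add: sum.cartesian_product)

lemma L2_set_cube_sq: "(L2_set f (cube N))\<^sup>2 = (\<Sum>i<N. \<Sum>j<N. \<Sum>k<N. (f (i, j, k))\<^sup>2)"
  by (simp add: L2_set_def sum_nonneg sum_cube)

lemma hs_norm_sq: "(hs_norm N A)\<^sup>2 = (\<Sum>i<N. \<Sum>j<N. (A i j)\<^sup>2)"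
  by (simp add: hs_norm_def L2_set_def sum_nonneg sum.cartesian_product case_prod_unfold)

lemma hs_norm_rows: "(hs_norm N A)\<^sup>2 = (\<Sum>i<N. (L2_set (A i) {..<N})\<^sup>2)"
  by (simp add: hs_norm_sq L2_set_def sum_nonneg)

lemma hs_norm_nonneg [simp]: "0 \<le> hs_norm N A"
  by (simp add: hs_norm_def)

text \<open>The coordinates of \<open>(A \<otimes> B \<otimes> C) \<phi>\<close>, over a general
  ring because the chaining takes place over the reals and the Weyl matrices are complex.\<close>

definition tens_apply :: "nat \<Rightarrow> (nat \<Rightarrow> nat \<Rightarrow> 'a) \<Rightarrow> (nat \<Rightarrow> nat \<Rightarrow> 'a) \<Rightarrow> (nat \<Rightarrow> nat \<Rightarrow> 'a)
    \<Rightarrow> (nat \<times> nat \<times> nat \<Rightarrow> 'a) \<Rightarrow> nat \<times> nat \<times> nat \<Rightarrow> 'a :: comm_ring_1"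
  where "tens_apply N A B C \<phi> = (\<lambda>(i, j, k).
    \<Sum>i'<N. \<Sum>j'<N. \<Sum>k'<N. A i i' * B j j' * C k k' * \<phi> (i', j', k'))"

text \<open>An upper bound for the injective tensor norm of \<open>\<phi>\<close>; absolute values
  may be omitted since \<open>a\<close> can be replaced by its negative.\<close>

definition trilinear_le :: "nat \<Rightarrow> (nat \<times> nat \<times> nat \<Rightarrow> real) \<Rightarrow> real \<Rightarrow> bool"
  where "trilinear_le N \<phi> S \<longleftrightarrow> (\<forall>a b c. (\<Sum>i<N. \<Sum>j<N. \<Sum>k<N. \<phi> (i, j, k) * a i * b j * c k)
    \<le> S * L2_set a {..<N} * L2_set b {..<N} * L2_set c {..<N})"

text \<open>As in \<open>op_le_test\<close>: each round frees one argument from the test set, at the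
  price of its Euclidean norm only.\<close>

lemma trilinear_le_test:
  assumes test: "\<And>z z' z''. z \<in> test_vectors N \<Longrightarrow> z' \<in> test_vectors N \<Longrightarrow> z'' \<in> test_vectors N
    \<Longrightarrow> (\<Sum>i<N. \<Sum>j<N. \<Sum>k<N. \<phi> (i, j, k) * z i * z' j * z'' k) \<le> S"
  shows "trilinear_le N \<phi> S"
  unfolding trilinear_le_def
proof (intro allI)
  fix a b c :: "nat \<Rightarrow> real"
  let ?n = "\<lambda>x. L2_set x {..<N}"
  have 1: "?n (\<lambda>k. \<Sum>i<N. \<Sum>j<N. \<phi> (i, j, k) * z i * z' j) \<le> S"
    if z: "z \<in> test_vectors N" "z' \<in> test_vectors N" for z z'
  proof (rule L2_set_le_test)
    fix z'' assume "z'' \<in> test_vectors N"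
    note test[OF z this]
    also have "(\<Sum>i<N. \<Sum>j<N. \<Sum>k<N. \<phi> (i, j, k) * z i * z' j * z'' k)
        = (\<Sum>k<N. \<Sum>i<N. \<Sum>j<N. \<phi> (i, j, k) * z i * z' j * z'' k)"
      by (rule sum_rotate3)
    finally show "(\<Sum>k<N. (\<Sum>i<N. \<Sum>j<N. \<phi> (i, j, k) * z i * z' j) * z'' k) \<le> S"
      by (simp add: sum_distrib_right)
  qed
  have 2: "?n (\<lambda>j. \<Sum>i<N. \<Sum>k<N. \<phi> (i, j, k) * z i * c k) \<le> S * ?n c" if z: "z \<in> test_vectors N" for z
  proof (rule L2_set_le_test)
    fix z' assume z': "z' \<in> test_vectors N"
    have "(\<Sum>j<N. (\<Sum>i<N. \<Sum>k<N. \<phi> (i, j, k) * z i * c k) * z' j)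
        = (\<Sum>i<N. \<Sum>j<N. \<Sum>k<N. \<phi> (i, j, k) * z i * c k * z' j)"
      unfolding sum_distrib_right by (rule sum.swap)
    also have "\<dots> = (\<Sum>k<N. (\<Sum>i<N. \<Sum>j<N. \<phi> (i, j, k) * z i * z' j) * c k)"
      unfolding sum_distrib_right by (subst sum_rotate3) (simp add: mult_ac)
    also have "\<dots> \<le> ?n (\<lambda>k. \<Sum>i<N. \<Sum>j<N. \<phi> (i, j, k) * z i * z' j) * ?n c"
      by (rule sum_mult_le_L2_set)
    also have "\<dots> \<le> S * ?n c"
      by (intro mult_right_mono 1 z z') simp
    finally show "(\<Sum>j<N. (\<Sum>i<N. \<Sum>k<N. \<phi> (i, j, k) * z i * c k) * z' j) \<le> S * ?n c" .
  qed
  have 3: "?n (\<lambda>i. \<Sum>j<N. \<Sum>k<N. \<phi> (i, j, k) * b j * c k) \<le> S * ?n b * ?n c"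
  proof (rule L2_set_le_test)
    fix z assume z: "z \<in> test_vectors N"
    have "(\<Sum>i<N. (\<Sum>j<N. \<Sum>k<N. \<phi> (i, j, k) * b j * c k) * z i)
        = (\<Sum>j<N. (\<Sum>i<N. \<Sum>k<N. \<phi> (i, j, k) * z i * c k) * b j)"
      unfolding sum_distrib_right by (subst sum.swap) (simp add: mult_ac)
    also have "\<dots> \<le> ?n (\<lambda>j. \<Sum>i<N. \<Sum>k<N. \<phi> (i, j, k) * z i * c k) * ?n b"
      by (rule sum_mult_le_L2_set)
    also have "\<dots> \<le> (S * ?n c) * ?n b"
      by (intro mult_right_mono 2 z) simp
    finally show "(\<Sum>i<N. (\<Sum>j<N. \<Sum>k<N. \<phi> (i, j, k) * b j * c k) * z i) \<le> S * ?n b * ?n c"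
      by (simp add: mult_ac)
  qed
  have "(\<Sum>i<N. \<Sum>j<N. \<Sum>k<N. \<phi> (i, j, k) * a i * b j * c k)
      = (\<Sum>i<N. (\<Sum>j<N. \<Sum>k<N. \<phi> (i, j, k) * b j * c k) * a i)"
    unfolding sum_distrib_right by (simp add: mult_ac)
  also have "\<dots> \<le> ?n (\<lambda>i. \<Sum>j<N. \<Sum>k<N. \<phi> (i, j, k) * b j * c k) * ?n a"
    by (rule sum_mult_le_L2_set)
  also have "\<dots> \<le> (S * ?n b * ?n c) * ?n a"
    by (intro mult_right_mono 3) simp
  finally show "(\<Sum>i<N. \<Sum>j<N. \<Sum>k<N. \<phi> (i, j, k) * a i * b j * c k) \<le> S * ?n a * ?n b * ?n c"
    by (simp add: mult_ac)
qed

text \<open>Duality, with the contraction itself as the third argument.\<close>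

lemma L2_set_contract_le:
  assumes S: "trilinear_le N \<phi> S" "0 \<le> S"
  shows "L2_set (\<lambda>k. \<Sum>i<N. \<Sum>j<N. \<phi> (i, j, k) * a i * b j) {..<N} \<le> S * L2_set a {..<N} * L2_set b {..<N}"
proof -
  let ?n = "\<lambda>x. L2_set x {..<N}"
  define v where "v = (\<lambda>k. \<Sum>i<N. \<Sum>j<N. \<phi> (i, j, k) * a i * b j)"
  have "(?n v)\<^sup>2 = (\<Sum>k<N. v k * v k)" by (rule sum_self_mult_eq_L2_set[symmetric])
  also have "\<dots> = (\<Sum>k<N. \<Sum>i<N. \<Sum>j<N. \<phi> (i, j, k) * a i * b j * v k)"
    by (subst (1) v_def) (simp add: sum_distrib_right)
  also have "\<dots> = (\<Sum>i<N. \<Sum>j<N. \<Sum>k<N. \<phi> (i, j, k) * a i * b j * v k)"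
    by (rule sum_rotate3[symmetric])
  also have "\<dots> \<le> S * ?n a * ?n b * ?n v" using S by (simp add: trilinear_le_def)
  finally have le: "?n v * ?n v \<le> (S * ?n a * ?n b) * ?n v" by (simp add: power2_eq_square)
  show ?thesis
  proof (cases "?n v = 0")
    case True
    then show ?thesis using S(2) by (simp add: v_def)
  next
    case False
    then have "?n v > 0" using L2_set_nonneg[of v "{..<N}"] by linarith
    then have "?n v \<le> S * ?n a * ?n b" using le by (rule mult_right_le_imp_le[rotated])
    then show ?thesis by (simp add: v_def)
  qed
qed

text \<open>For fixed \<open>i, j\<close> the output is \<open>C\<close> applied to the contraction
  of \<open>\<phi>\<close> with row \<open>i\<close> of \<open>A\<close> and row \<open>j\<close> of
  \<open>B\<close>, which has norm at most \<open>S\<close> times the norms of the two rows. Summing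
  the squares over all rows produces the Hilbert-Schmidt norms.\<close>

lemma L2_set_tens_apply_le3:
  assumes S: "trilinear_le N \<phi> S" "0 \<le> S" and C: "op_le N C t" "0 \<le> t"
  shows "L2_set (tens_apply N A B C \<phi>) (cube N) \<le> S * hs_norm N A * hs_norm N B * t"
proof (rule power2_le_imp_le)
  let ?n = "\<lambda>x. L2_set x {..<N}"
  have row: "(\<Sum>k<N. (tens_apply N A B C \<phi> (i, j, k))\<^sup>2) \<le> (t * S)\<^sup>2 * ((?n (A i))\<^sup>2 * (?n (B j))\<^sup>2)" for i j
  proof -
    define v where "v k' = (\<Sum>i'<N. \<Sum>j'<N. \<phi> (i', j', k') * A i i' * B j j')" for k'
    have v: "tens_apply N A B C \<phi> (i, j, k) = (\<Sum>k'<N. C k k' * v k')" for k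
    proof -
      have "(\<Sum>k'<N. C k k' * v k') = (\<Sum>k'<N. \<Sum>i'<N. \<Sum>j'<N. A i i' * B j j' * C k k' * \<phi> (i', j', k'))"
        by (simp add: v_def sum_distrib_left mult_ac)
      also have "\<dots> = (\<Sum>i'<N. \<Sum>j'<N. \<Sum>k'<N. A i i' * B j j' * C k k' * \<phi> (i', j', k'))"
        by (rule sum_rotate3[symmetric])
      finally show ?thesis by (simp add: tens_apply_def)
    qed
    have "?n (\<lambda>k. \<Sum>k'<N. C k k' * v k') \<le> t * ?n v" using C by (simp add: op_le_def)
    also have "\<dots> \<le> t * (S * ?n (A i) * ?n (B j))"
      unfolding v_def using C by (intro mult_left_mono L2_set_contract_le S)
    finally have "(?n (\<lambda>k. \<Sum>k'<N. C k k' * v k'))\<^sup>2 \<le> (t * (S * ?n (A i) * ?n (B j)))\<^sup>2"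
      by (intro power_mono) auto
    then show ?thesis
      by (simp add: v L2_set_def sum_nonneg power_mult_distrib mult_ac)
  qed
  have "(L2_set (tens_apply N A B C \<phi>) (cube N))\<^sup>2 \<le> (\<Sum>i<N. \<Sum>j<N. (t * S)\<^sup>2 * ((?n (A i))\<^sup>2 * (?n (B j))\<^sup>2))"
    unfolding L2_set_cube_sq by (intro sum_mono row)
  also have "\<dots> = (t * S)\<^sup>2 * ((hs_norm N A)\<^sup>2 * (hs_norm N B)\<^sup>2)"
    unfolding hs_norm_rows sum_product by (simp add: sum_distrib_left)
  finally show "(L2_set (tens_apply N A B C \<phi>) (cube N))\<^sup>2 \<le> (S * hs_norm N A * hs_norm N B * t)\<^sup>2"
    by (simp add: power_mult_distrib mult_ac)
qed (use assms in simp)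

text \<open>Cyclic rotation of the three legs transfers the bound to the other two positions.\<close>

lemma tens_apply_rotate:
  "tens_apply N A B C \<phi> (i, j, k) = tens_apply N C A B (\<lambda>(k, i, j). \<phi> (i, j, k)) (k, i, j)"
  unfolding tens_apply_def by (simp add: mult_ac) (rule sum_rotate3)

lemma L2_set_tens_apply_rotate:
  "L2_set (tens_apply N A B C \<phi>) (cube N) = L2_set (tens_apply N C A B (\<lambda>(k, i, j). \<phi> (i, j, k))) (cube N)"
  unfolding L2_set_def sum_cube by (subst tens_apply_rotate) (rule arg_cong[where f = sqrt], rule sum_rotate3)

lemma trilinear_le_rotate:
  assumes "trilinear_le N \<phi> S"
  shows "trilinear_le N (\<lambda>(k, i, j). \<phi> (i, j, k)) S"
  unfolding trilinear_le_def
proof (intro allI)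
  fix c a b :: "nat \<Rightarrow> real"
  have "(\<Sum>k<N. \<Sum>i<N. \<Sum>j<N. \<phi> (i, j, k) * a i * b j * c k) = (\<Sum>i<N. \<Sum>j<N. \<Sum>k<N. \<phi> (i, j, k) * a i * b j * c k)"
    by (rule sum_rotate3[symmetric])
  also have "\<dots> \<le> S * L2_set a {..<N} * L2_set b {..<N} * L2_set c {..<N}"
    using assms by (simp add: trilinear_le_def)
  finally show "(\<Sum>k<N. \<Sum>i<N. \<Sum>j<N. (case (k, i, j) of (k, i, j) \<Rightarrow> \<phi> (i, j, k)) * c k * a i * b j)
      \<le> S * L2_set c {..<N} * L2_set a {..<N} * L2_set b {..<N}"
    by (simp add: mult_ac)
qed

lemma L2_set_tens_apply_le2:
  assumes S: "trilinear_le N \<phi> S" "0 \<le> S" and B: "op_le N B t" "0 \<le> t"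
  shows "L2_set (tens_apply N A B C \<phi>) (cube N) \<le> S * hs_norm N A * hs_norm N C * t"
  using L2_set_tens_apply_le3[OF trilinear_le_rotate[OF S(1)] S(2) B, of C A]
  by (simp add: L2_set_tens_apply_rotate[of N A B C] mult_ac)

lemma L2_set_tens_apply_le1:
  assumes S: "trilinear_le N \<phi> S" "0 \<le> S" and A: "op_le N A t" "0 \<le> t"
  shows "L2_set (tens_apply N A B C \<phi>) (cube N) \<le> S * hs_norm N B * hs_norm N C * t"
  using L2_set_tens_apply_le2[OF trilinear_le_rotate[OF S(1)] S(2) A, of C B]
  by (simp add: L2_set_tens_apply_rotate[of N A B C] mult_ac)

section \<open>Approximation in operator norm\<close>

lemma op_le_hs_norm: "op_le N A (hs_norm N A)"
  unfolding op_le_def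
proof (rule allI, rule power2_le_imp_le)
  fix x
  have "(L2_set (\<lambda>i. \<Sum>j<N. A i j * x j) {..<N})\<^sup>2 = (\<Sum>i<N. (\<Sum>j<N. A i j * x j)\<^sup>2)"
    by (simp add: L2_set_def sum_nonneg)
  also have "\<dots> \<le> (\<Sum>i<N. (L2_set (A i) {..<N} * L2_set x {..<N})\<^sup>2)"
    by (intro sum_mono abs_le_square_iff[THEN iffD1]) (use abs_sum_mult_le_L2_set in simp)
  also have "\<dots> = (hs_norm N A * L2_set x {..<N})\<^sup>2"
    by (simp add: power_mult_distrib hs_norm_rows sum_distrib_right)
  finally show "(L2_set (\<lambda>i. \<Sum>j<N. A i j * x j) {..<N})\<^sup>2 \<le> (hs_norm N A * L2_set x {..<N})\<^sup>2" .
qed simp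

lemma op_le_mono: "op_le N A s \<Longrightarrow> s \<le> t \<Longrightarrow> op_le N A t"
  unfolding op_le_def by (meson L2_set_nonneg mult_right_mono order_trans)

lemma op_le_diff:
  assumes "op_le N A s" "op_le N B t"
  shows "op_le N (\<lambda>i j. A i j - B i j) (s + t)"
  unfolding op_le_def
proof
  fix x
  let ?a = "\<lambda>i. \<Sum>j<N. A i j * x j" and ?b = "\<lambda>i. \<Sum>j<N. B i j * x j"
  have "L2_set (\<lambda>i. ?a i + - ?b i) {..<N} \<le> L2_set ?a {..<N} + L2_set (\<lambda>i. - ?b i) {..<N}"
    by (rule L2_set_triangle_ineq)
  also have "L2_set (\<lambda>i. - ?b i) {..<N} = L2_set ?b {..<N}" by (simp add: L2_set_def)
  also have "L2_set ?a {..<N} + L2_set ?b {..<N} \<le> s * L2_set x {..<N} + t * L2_set x {..<N}"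
    using assms by (intro add_mono) (auto simp: op_le_def)
  finally show "L2_set (\<lambda>i. \<Sum>j<N. (A i j - B i j) * x j) {..<N} \<le> (s + t) * L2_set x {..<N}"
    by (simp add: left_diff_distrib sum_subtractf distrib_right)
qed

lemma hs_norm_add_le: "hs_norm N (\<lambda>i j. A i j + B i j) \<le> hs_norm N A + hs_norm N B"
  unfolding hs_norm_def case_prod_unfold by (rule L2_set_triangle_ineq)

lemma hs_norm_uminus: "hs_norm N (\<lambda>i j. - A i j) = hs_norm N A"
  unfolding hs_norm_def by (simp add: L2_set_def case_prod_unfold)

text \<open>Matrices of rank at most \<open>r\<close> in a form that keeps them finite in number:
  the coefficient \<open>e\<close> is the same for all terms, and both vectors of each term are test
  vectors.\<close>

primrec rank_net :: "nat \<Rightarrow> real \<Rightarrow> nat \<Rightarrow> (nat \<Rightarrow> nat \<Rightarrow> real) set"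
  where "rank_net N e 0 = {\<lambda>_ _. 0}"
  | "rank_net N e (Suc r) = (\<lambda>(A, z, z') i j. A i j + e * z i * z' j) `
      (rank_net N e r \<times> test_vectors N \<times> test_vectors N)"

lemma finite_rank_net: "finite (rank_net N e r)"
  by (induction r) (auto simp: finite_test_vectors)

lemma card_rank_net: "card (rank_net N e r) \<le> 48 ^ (2 * N * r)"
proof (induction r)
  case (Suc r)
  have "card (rank_net N e (Suc r)) \<le> card (rank_net N e r \<times> test_vectors N \<times> test_vectors N)"
    unfolding rank_net.simps by (intro card_image_le) (auto simp: finite_test_vectors finite_rank_net)
  also have "\<dots> = card (rank_net N e r) * (card (test_vectors N) * card (test_vectors N))"
    by (simp add: card_cartesian_product)
  also have "\<dots> \<le> 48 ^ (2 * N * r) * (48 ^ N * 48 ^ N)"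
    by (intro mult_mono Suc card_test_vectors) auto
  also have "\<dots> = 48 ^ (2 * N * Suc r)"
    by (simp add: mult_2 flip: power_add)
  finally show ?case .
qed simp

lemma zero_rank_net: "(\<lambda>_ _. 0) \<in> rank_net N e r"
proof (induction r)
  case (Suc r)
  then show ?case
    using zero_test_vectors[of N] by (auto intro!: image_eqI[of _ _ "(\<lambda>_ _. 0, \<lambda>_. 0, \<lambda>_. 0)"])
qed simp

lemma rank_net_mono_Suc: "A \<in> rank_net N e r \<Longrightarrow> A \<in> rank_net N e (Suc r)"
  using zero_test_vectors[of N] by (auto intro!: image_eqI[of _ _ "(A, \<lambda>_. 0, \<lambda>_. 0)"])

lemma hs_norm_sub_rank_one:
  "(hs_norm N (\<lambda>i j. R i j - e * z i * z' j))\<^sup>2 = (hs_norm N R)\<^sup>2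
    - 2 * e * (\<Sum>i<N. \<Sum>j<N. R i j * z i * z' j) + e\<^sup>2 * (L2_set z {..<N})\<^sup>2 * (L2_set z' {..<N})\<^sup>2"
proof -
  have "(R i j - e * z i * z' j)\<^sup>2 = (R i j)\<^sup>2 - 2 * e * (R i j * z i * z' j) + e\<^sup>2 * ((z i)\<^sup>2 * (z' j)\<^sup>2)" for i j
    by (simp add: power2_eq_square algebra_simps)
  then have "(hs_norm N (\<lambda>i j. R i j - e * z i * z' j))\<^sup>2 = (\<Sum>i<N. \<Sum>j<N. (R i j)\<^sup>2)
      - 2 * e * (\<Sum>i<N. \<Sum>j<N. R i j * z i * z' j) + e\<^sup>2 * (\<Sum>i<N. \<Sum>j<N. (z i)\<^sup>2 * (z' j)\<^sup>2)"
    by (simp add: hs_norm_sq sum.distrib sum_subtractf sum_distrib_left)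
  also have "(\<Sum>i<N. \<Sum>j<N. (z i)\<^sup>2 * (z' j)\<^sup>2) = (L2_set z {..<N})\<^sup>2 * (L2_set z' {..<N})\<^sup>2"
    unfolding L2_set_def by (simp add: sum_nonneg sum_product)
  finally show ?thesis by (simp add: hs_norm_sq mult_ac)
qed

text \<open>Greedy approximation: while some pair of test vectors witnesses a large operator norm of the
  residual, subtracting the corresponding rank one matrix lowers the squared Hilbert-Schmidt norm
  by a fixed amount.\<close>

lemma rank_net_greedy:
  assumes A: "hs_norm N A \<le> 1" and e: "0 < e"
  shows "\<exists>A'\<in>rank_net N e r. hs_norm N (\<lambda>i j. A i j - A' i j) \<le> 1 \<and>
    (op_le N (\<lambda>i j. A i j - A' i j) (16 * e) \<or> (hs_norm N (\<lambda>i j. A i j - A' i j))\<^sup>2 \<le> 1 - 16 * e\<^sup>2 * real r)"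
proof (induction r)
  case 0
  then show ?case using A power_mono[of "hs_norm N A" 1 2] by simp
next
  case (Suc r)
  then obtain A' where A': "A' \<in> rank_net N e r" and le: "hs_norm N (\<lambda>i j. A i j - A' i j) \<le> 1"
    and alt: "op_le N (\<lambda>i j. A i j - A' i j) (16 * e) \<or> (hs_norm N (\<lambda>i j. A i j - A' i j))\<^sup>2 \<le> 1 - 16 * e\<^sup>2 * real r"
    by blast
  let ?R = "\<lambda>i j. A i j - A' i j"
  show ?case
  proof (cases "op_le N ?R (16 * e)")
    case True
    then show ?thesis using rank_net_mono_Suc[OF A'] le by blast
  next
    case False
    then obtain z z' where z: "z \<in> test_vectors N" "z' \<in> test_vectors N"
      and big: "(\<Sum>i<N. \<Sum>j<N. ?R i j * z i * z' j) > 16 * e"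
      using op_le_test[of N ?R "16 * e"] by (meson not_le)
    define B where "B = (\<lambda>i j. A' i j + e * z i * z' j)"
    have B: "B \<in> rank_net N e (Suc r)"
      unfolding B_def using A' z by (auto intro!: image_eqI[of _ _ "(A', z, z')"])
    have sq4: "(L2_set z {..<N})\<^sup>2 \<le> 4" if "z \<in> test_vectors N" for z
      using power_mono[OF L2_set_test_vectors[OF that] L2_set_nonneg, of 2] by simp
    have "(hs_norm N (\<lambda>i j. A i j - B i j))\<^sup>2 = (hs_norm N (\<lambda>i j. ?R i j - e * z i * z' j))\<^sup>2"
      by (simp add: B_def algebra_simps)
    \<comment> \<open>This balance explains the threshold \<open>16 * e\<close>: the cross term
      gains more than \<open>32 * e\<^sup>2\<close>, and the square of the subtracted matrix costs
      at most \<open>16 * e\<^sup>2\<close>, as test vectors have squared norm at most 4.\<close>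
    also have "\<dots> \<le> (hs_norm N ?R)\<^sup>2 - 2 * e * (16 * e) + e\<^sup>2 * (4 * 4)"
    proof -
      have "2 * e * (16 * e) \<le> 2 * e * (\<Sum>i<N. \<Sum>j<N. ?R i j * z i * z' j)"
        using big e by (intro mult_left_mono) auto
      moreover have "e\<^sup>2 * ((L2_set z {..<N})\<^sup>2 * (L2_set z' {..<N})\<^sup>2) \<le> e\<^sup>2 * (4 * 4)"
        using z by (intro mult_left_mono mult_mono sq4) auto
      ultimately show ?thesis unfolding hs_norm_sub_rank_one by (simp add: mult.assoc)
    qed
    also have "\<dots> = (hs_norm N ?R)\<^sup>2 - 16 * e\<^sup>2" by (simp add: power2_eq_square)
    finally have dec: "(hs_norm N (\<lambda>i j. A i j - B i j))\<^sup>2 \<le> (hs_norm N ?R)\<^sup>2 - 16 * e\<^sup>2" .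
    have "(hs_norm N (\<lambda>i j. A i j - B i j))\<^sup>2 \<le> 1\<^sup>2"
    proof -
      have "(hs_norm N ?R)\<^sup>2 \<le> 1\<^sup>2" using le by (intro power_mono) auto
      moreover have "0 \<le> e\<^sup>2" by simp
      ultimately show ?thesis using dec by linarith
    qed
    then have "hs_norm N (\<lambda>i j. A i j - B i j) \<le> 1" by (rule power2_le_imp_le) simp
    moreover have "(hs_norm N (\<lambda>i j. A i j - B i j))\<^sup>2 \<le> 1 - 16 * e\<^sup>2 * real (Suc r)"
      using dec alt False by (simp add: algebra_simps)
    ultimately show ?thesis using B by blast
  qed
qed

text \<open>With \<open>e = 1 / (2 * 2 ^ k)\<close> the error \<open>16 * e\<close> is
  \<open>8 / 2 ^ k\<close>, and \<open>4 ^ k\<close> greedy steps would lower the squared norm by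
  \<open>16 * e\<^sup>2 * 4 ^ k = 4\<close>. As it starts at most at 1, the procedure must have
  reached the operator norm bound before.\<close>

definition level_net :: "nat \<Rightarrow> nat \<Rightarrow> (nat \<Rightarrow> nat \<Rightarrow> real) set"
  where "level_net N k = rank_net N (1 / (2 * 2 ^ k)) (4 ^ k)"

lemma level_net_approx:
  assumes A: "hs_norm N A \<le> 1"
  shows "\<exists>A'\<in>level_net N k. hs_norm N (\<lambda>i j. A i j - A' i j) \<le> 1 \<and> op_le N (\<lambda>i j. A i j - A' i j) (8 / 2 ^ k)"
proof -
  have e: "16 * (1 / (2 * 2 ^ k :: real))\<^sup>2 * real (4 ^ k) = 4"
  proof -
    have "(4 :: real) ^ k = (2 ^ k)\<^sup>2" by (simp add: power2_eq_square flip: power_mult_distrib)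
    then show ?thesis by (simp add: power_divide power_mult_distrib)
  qed
  have sq: "\<not> (hs_norm N R)\<^sup>2 \<le> - 3" for R
    using zero_le_power2[of "hs_norm N R"] by linarith
  show ?thesis
    using rank_net_greedy[OF A, of "1 / (2 * 2 ^ k)" "4 ^ k"] unfolding e level_net_def by (auto simp: sq)
qed

lemma finite_level_net: "finite (level_net N k)"
  and card_level_net: "card (level_net N k) \<le> 48 ^ (2 * N * 4 ^ k)"
  and zero_level_net: "(\<lambda>_ _. 0) \<in> level_net N k"
  unfolding level_net_def by (rule finite_rank_net card_rank_net zero_rank_net)+

section \<open>Chaining\<close>

lemma L2_set_product3:
  "L2_set (\<lambda>(i, j, k). a i * b j * c k) (cube N) = L2_set a {..<N} * L2_set b {..<N} * L2_set c {..<N}"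
proof -
  have "(L2_set (\<lambda>(i, j, k). a i * b j * c k) (cube N))\<^sup>2 = (L2_set a {..<N} * L2_set b {..<N} * L2_set c {..<N})\<^sup>2"
    unfolding L2_set_cube_sq
    by (simp add: power_mult_distrib L2_set_def sum_nonneg flip: sum_distrib_left sum_distrib_right)
  then show ?thesis by (simp add: power2_eq_iff_nonneg)
qed

lemma forty_eight_power_le_exp: "48 ^ n \<le> exp (6 * real n)"
proof -
  have "(2 :: real) ^ 6 \<le> exp 1 ^ 6"
    using exp_ge_add_one_self[of 1] by (intro power_mono) auto
  then have "(48 :: real) \<le> exp 6" by (simp flip: exp_of_nat_mult)
  then have "(48 :: real) ^ n \<le> exp 6 ^ n" by (intro power_mono) auto
  then show ?thesis by (simp add: mult.commute flip: exp_of_nat_mult)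
qed

text \<open>Union bound over the triples of test vectors: there are at most
  \<open>exp (18 * N)\<close> of them, against tails \<open>2 * exp (- 49 * N / 2)\<close> at
  deviation \<open>7 * sqrt N\<close>. In \<open>56 = 7 * 2 ^ 3\<close> the factor 8 bounds the
  product of three test vector norms.\<close>

lemma exists_trilinear_le:
  assumes N: "N > 0"
  shows "\<exists>\<phi>. (\<forall>p\<in>cube N. \<bar>\<phi> p\<bar> = 1) \<and> trilinear_le N \<phi> (56 * sqrt (real N))"
proof -
  define M where "M = test_vectors N \<times> test_vectors N \<times> test_vectors N"
  define \<theta> :: "_ \<Rightarrow> nat \<times> nat \<times> nat \<Rightarrow> real"
    where "\<theta> = (\<lambda>(z, z', z'') (i, j, k). z i * z' j * z'' k)"
  have finM: "finite M" by (simp add: M_def finite_test_vectors)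
  have "card M = card (test_vectors N) * (card (test_vectors N) * card (test_vectors N))"
    by (simp add: M_def card_cartesian_product)
  also have "\<dots> \<le> 48 ^ N * (48 ^ N * 48 ^ N)"
    by (intro mult_mono card_test_vectors) auto
  also have "\<dots> = 48 ^ (3 * N)" by (simp flip: power_add)
  finally have "real (card M) \<le> 48 ^ (3 * N)"
    by (metis of_nat_le_iff of_nat_numeral of_nat_power)
  also have "\<dots> \<le> exp (18 * real N)" using forty_eight_power_le_exp[of "3 * N"] by simp
  finally have card: "real (card M) \<le> exp (18 * real N)" .
  have "(\<Sum>m\<in>M. 2 * exp (- (7 * sqrt (real N))\<^sup>2 / 2)) = real (card M) * (2 * exp (- (49/2) * real N))"
    by (simp add: power_mult_distrib)
  also have "\<dots> \<le> exp (18 * real N) * (2 * exp (- (49/2) * real N))"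
    by (intro mult_right_mono card) auto
  also have "\<dots> = 2 * exp (- (13/2) * real N)"
    by (simp add: algebra_simps flip: exp_add)
  also have "\<dots> \<le> 2 * exp (- 2)" using N by simp
  also have "\<dots> < 1" using exp_ge_add_one_self[of 2] by (simp add: exp_minus field_simps)
  finally have ub: "(\<Sum>m\<in>M. 2 * exp (- (7 * sqrt (real N))\<^sup>2 / 2)) < 1" .
  obtain \<phi> where \<phi>: "\<forall>p\<in>cube N. \<bar>\<phi> p\<bar> = 1"
    and le: "\<forall>m\<in>M. \<bar>\<Sum>p\<in>cube N. \<phi> p * \<theta> m p\<bar> \<le> 7 * sqrt (real N) * L2_set (\<theta> m) (cube N)"
    using signs_exist[OF finite_cube[of N] finM _ ub, where \<theta> = \<theta>] by auto
  have "trilinear_le N \<phi> (56 * sqrt (real N))"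
  proof (rule trilinear_le_test)
    fix z z' z'' assume z: "z \<in> test_vectors N" "z' \<in> test_vectors N" "z'' \<in> test_vectors N"
    have "L2_set (\<theta> (z, z', z'')) (cube N) = L2_set z {..<N} * L2_set z' {..<N} * L2_set z'' {..<N}"
      by (simp add: \<theta>_def L2_set_product3)
    also have "\<dots> \<le> 2 * 2 * 2"
      using z by (intro mult_mono L2_set_test_vectors) auto
    finally have "7 * sqrt (real N) * L2_set (\<theta> (z, z', z'')) (cube N) \<le> 7 * sqrt (real N) * 8"
      by (intro mult_left_mono) auto
    moreover have "(\<Sum>i<N. \<Sum>j<N. \<Sum>k<N. \<phi> (i, j, k) * z i * z' j * z'' k) = (\<Sum>p\<in>cube N. \<phi> p * \<theta> (z, z', z'') p)"
      by (simp add: sum_cube \<theta>_def mult.assoc)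
    ultimately show "(\<Sum>i<N. \<Sum>j<N. \<Sum>k<N. \<phi> (i, j, k) * z i * z' j * z'' k) \<le> 56 * sqrt (real N)"
      using bspec[OF le, of "(z, z', z'')"] z by (auto simp: M_def)
  qed
  with \<phi> show ?thesis by blast
qed

section \<open>Increments along a chain of approximations\<close>

lemma tens_apply_diff:
  fixes A :: "nat \<Rightarrow> nat \<Rightarrow> 'a :: comm_ring_1"
  shows "tens_apply N A B C \<phi> p - tens_apply N A' B' C' \<phi> p
    = tens_apply N (\<lambda>i j. A i j - A' i j) B C \<phi> p + tens_apply N A' (\<lambda>i j. B i j - B' i j) C \<phi> p
      + tens_apply N A' B' (\<lambda>i j. C i j - C' i j) \<phi> p"
  by (cases p) (simp add: tens_apply_def algebra_simps flip: sum_subtractf sum.distrib)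

text \<open>One factor is replaced at a time. The differing factor is measured in operator norm and
  the other two in Hilbert-Schmidt norm, at most \<open>2 * 2\<close>; three replacements give
  12.\<close>

lemma L2_set_tens_apply_diff:
  assumes S: "trilinear_le N \<phi> S" "0 \<le> S" and t: "0 \<le> t"
    and hs: "hs_norm N A' \<le> 2" "hs_norm N B \<le> 2" "hs_norm N B' \<le> 2" "hs_norm N C \<le> 2"
    and op: "op_le N (\<lambda>i j. A i j - A' i j) t" "op_le N (\<lambda>i j. B i j - B' i j) t" "op_le N (\<lambda>i j. C i j - C' i j) t"
  shows "L2_set (\<lambda>p. tens_apply N A B C \<phi> p - tens_apply N A' B' C' \<phi> p) (cube N) \<le> 12 * S * t"
proof -
  let ?T1 = "tens_apply N (\<lambda>i j. A i j - A' i j) B C \<phi>"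
  let ?T2 = "tens_apply N A' (\<lambda>i j. B i j - B' i j) C \<phi>"
  let ?T3 = "tens_apply N A' B' (\<lambda>i j. C i j - C' i j) \<phi>"
  have four: "S * x * y * t \<le> 4 * S * t" if "x \<le> 2" "y \<le> 2" "0 \<le> x" "0 \<le> y" for x y
  proof -
    have "x * y \<le> 2 * 2" using that by (intro mult_mono) auto
    then have "(S * t) * (x * y) \<le> (S * t) * 4" using S t by (intro mult_left_mono) auto
    then show ?thesis by (simp add: mult_ac)
  qed
  have "L2_set (\<lambda>p. tens_apply N A B C \<phi> p - tens_apply N A' B' C' \<phi> p) (cube N)
      = L2_set (\<lambda>p. ?T1 p + ?T2 p + ?T3 p) (cube N)"
    by (subst tens_apply_diff) simp
  also have "\<dots> \<le> L2_set (\<lambda>p. ?T1 p + ?T2 p) (cube N) + L2_set ?T3 (cube N)"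
    by (rule L2_set_triangle_ineq)
  also have "L2_set (\<lambda>p. ?T1 p + ?T2 p) (cube N) \<le> L2_set ?T1 (cube N) + L2_set ?T2 (cube N)"
    by (rule L2_set_triangle_ineq)
  also have "L2_set ?T1 (cube N) \<le> 4 * S * t"
    by (rule order_trans[OF L2_set_tens_apply_le1[OF S op(1) t] four]) (use hs in auto)
  also have "L2_set ?T2 (cube N) \<le> 4 * S * t"
    by (rule order_trans[OF L2_set_tens_apply_le2[OF S op(2) t] four]) (use hs in auto)
  also have "L2_set ?T3 (cube N) \<le> 4 * S * t"
    by (rule order_trans[OF L2_set_tens_apply_le3[OF S op(3) t] four]) (use hs in auto)
  finally show ?thesis by simp
qed

text \<open>At level 0 the zero matrix can serve, since the operator norm is at most the
  Hilbert-Schmidt norm, hence at most 1; so the chain starts where the trilinear form vanishes. On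
  higher levels the norm bound 2 comes from the triangle inequality with a residual of norm at most
  1.\<close>

lemma level_net_sequence:
  assumes A: "hs_norm N A \<le> 1"
  shows "\<exists>a. a 0 = (\<lambda>_ _. 0) \<and> (\<forall>k. a k \<in> level_net N k \<and> hs_norm N (a k) \<le> 2 \<and>
    op_le N (\<lambda>i j. A i j - a k i j) (8 / 2 ^ k))"
proof -
  have "\<exists>A'. A' \<in> level_net N k \<and> hs_norm N A' \<le> 2 \<and> op_le N (\<lambda>i j. A i j - A' i j) (8 / 2 ^ k)
      \<and> (k = 0 \<longrightarrow> A' = (\<lambda>_ _. 0))" for k
  proof (cases "k = 0")
    case True
    have "op_le N A 8" using op_le_hs_norm by (rule op_le_mono) (use A in simp)
    then show ?thesis using True zero_level_net[of N 0] by (intro exI[of _ "\<lambda>_ _. 0"]) (simp add: hs_norm_def L2_set_def case_prod_unfold)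
  next
    case False
    obtain A' where A': "A' \<in> level_net N k" "hs_norm N (\<lambda>i j. A i j - A' i j) \<le> 1"
        "op_le N (\<lambda>i j. A i j - A' i j) (8 / 2 ^ k)"
      using level_net_approx[OF A] by blast
    have "hs_norm N A' = hs_norm N (\<lambda>i j. A i j + - (A i j - A' i j))" by simp
    also have "\<dots> \<le> hs_norm N A + hs_norm N (\<lambda>i j. - (A i j - A' i j))" by (rule hs_norm_add_le)
    also have "\<dots> \<le> 2" using A A'(2) unfolding hs_norm_uminus by simp
    finally show ?thesis using A' False by blast
  qed
  then have "\<forall>k. \<exists>A'. A' \<in> level_net N k \<and> hs_norm N A' \<le> 2 \<and> op_le N (\<lambda>i j. A i j - A' i j) (8 / 2 ^ k)
      \<and> (k = 0 \<longrightarrow> A' = (\<lambda>_ _. 0))" by blast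
  from choice[OF this] show ?thesis by auto
qed

lemma tens_apply_zero: "tens_apply N (\<lambda>_ _. 0) B C \<phi> p = 0"
  by (cases p) (simp add: tens_apply_def)

lemma sum_exp_level_bound: "(\<Sum>k<L. 2 * exp (- 14 * 4 ^ Suc k :: real)) < 1"
proof -
  have "(\<Sum>k<L. 2 * exp (- 14 * 4 ^ Suc k :: real)) \<le> (\<Sum>k<L. (1 / 2) ^ Suc (Suc k))"
  proof (rule sum_mono)
    fix k
    have "Suc k < 4 ^ Suc k" by (rule less_exp[THEN order_less_le_trans]) (intro power_mono, auto)
    then have "real (Suc k) < real (4 ^ Suc k)" by (simp only: of_nat_less_iff)
    then have "exp (- 14 * 4 ^ Suc k :: real) \<le> exp (- real (Suc (Suc (Suc k))))"
      by simp
    also have "\<dots> = exp (- 1) ^ Suc (Suc (Suc k))"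
      by (simp add: exp_of_nat_mult[symmetric] algebra_simps flip: exp_add)
    also have "\<dots> \<le> (1 / 2) ^ Suc (Suc (Suc k))"
      using exp_ge_add_one_self[of 1] by (intro power_mono) (auto simp: exp_minus field_simps)
    finally show "2 * exp (- 14 * 4 ^ Suc k :: real) \<le> (1 / 2) ^ Suc (Suc k)" by simp
  qed
  also have "\<dots> = 1 / 2 - (1 / 2) ^ Suc L" by (induction L) (auto simp: field_simps)
  also have "\<dots> < 1" using zero_less_power[of "1 / 2 :: real" "Suc L"] by linarith
  finally show ?thesis .
qed

lemma random_tensor_bound:
  assumes N: "N > 0" and L: "N \<le> 2 ^ L"
  shows "\<exists>\<psi> \<phi>. (\<forall>p\<in>cube N. \<bar>\<psi> p\<bar> = 1 \<and> \<bar>\<phi> p\<bar> = 1) \<and>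
    (\<forall>A B C. hs_norm N A \<le> 1 \<longrightarrow> hs_norm N B \<le> 1 \<longrightarrow> hs_norm N C \<le> 1 \<longrightarrow>
      \<bar>\<Sum>p\<in>cube N. \<psi> p * tens_apply N A B C \<phi> p\<bar> \<le> 300000 * real N * (real L + 1))"
proof -
  obtain \<phi> where \<phi>: "\<forall>p\<in>cube N. \<bar>\<phi> p\<bar> = 1" and S: "trilinear_le N \<phi> (56 * sqrt (real N))"
    using exists_trilinear_le[OF N] by blast
  define T where "T k = level_net N (Suc k) \<times> level_net N k" for k
  define M where "M = Sigma {..<L} (\<lambda>k. T k \<times> T k \<times> T k)"
  define \<theta> where "\<theta> = (\<lambda>(k :: nat, (A, A'), (B, B'), (C, C')) p. tens_apply N A B C \<phi> p - tens_apply N A' B' C' \<phi> p)"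
  \<comment> \<open>The deviation grows with the level just fast enough for the union bound: half
    its square is \<open>98 * N * 4 ^ Suc k\<close>, whereas there are at most
    \<open>exp (84 * N * 4 ^ Suc k)\<close> links at level \<open>k\<close>. The surplus
    \<open>14 * 4 ^ Suc k\<close> makes the failure bounds summable over all levels.\<close>
  define s where "s m = 14 * sqrt (real N) * 2 ^ Suc (fst m)" for m :: "nat \<times> ((nat \<Rightarrow> nat \<Rightarrow> real) \<times> (nat \<Rightarrow> nat \<Rightarrow> real))
    \<times> ((nat \<Rightarrow> nat \<Rightarrow> real) \<times> (nat \<Rightarrow> nat \<Rightarrow> real)) \<times> ((nat \<Rightarrow> nat \<Rightarrow> real) \<times> (nat \<Rightarrow> nat \<Rightarrow> real))"
  have s_nonneg: "0 \<le> s m" for m by (simp add: s_def)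
  have finT: "finite (T k)" for k by (simp add: T_def finite_level_net)
  then have finM: "finite M" by (simp add: M_def)
  have card: "real (card (T k \<times> T k \<times> T k)) \<le> exp (84 * real N * 4 ^ Suc k)" for k
  proof -
    have "card (T k) = card (level_net N (Suc k)) * card (level_net N k)"
      by (simp add: T_def card_cartesian_product)
    also have "\<dots> \<le> 48 ^ (2 * N * 4 ^ Suc k) * 48 ^ (2 * N * 4 ^ k)"
      by (intro mult_mono card_level_net) auto
    also have "\<dots> = 48 ^ (10 * N * 4 ^ k)" by (simp flip: power_add)
    finally have T: "card (T k) \<le> 48 ^ (10 * N * 4 ^ k)" .
    have "card (T k \<times> T k \<times> T k) = card (T k) * (card (T k) * card (T k))"
      by (simp add: card_cartesian_product)
    also have "\<dots> \<le> 48 ^ (10 * N * 4 ^ k) * (48 ^ (10 * N * 4 ^ k) * 48 ^ (10 * N * 4 ^ k))"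
      by (intro mult_mono T) auto
    also have "\<dots> = 48 ^ (30 * N * 4 ^ k)" by (simp flip: power_add)
    finally have "real (card (T k \<times> T k \<times> T k)) \<le> 48 ^ (30 * N * 4 ^ k)"
      by (metis of_nat_le_iff of_nat_numeral of_nat_power)
    also have "\<dots> \<le> exp (6 * real (30 * N * 4 ^ k))" by (rule forty_eight_power_le_exp)
    also have "\<dots> \<le> exp (84 * real N * 4 ^ Suc k)" by simp
    finally show ?thesis .
  qed
  have "(\<Sum>m\<in>M. 2 * exp (- (s m)\<^sup>2 / 2)) = (\<Sum>k<L. \<Sum>m\<in>T k \<times> T k \<times> T k. 2 * exp (- (14 * sqrt (real N) * 2 ^ Suc k)\<^sup>2 / 2))"
    unfolding M_def s_def by (subst sum.Sigma) (auto simp: finT case_prod_unfold)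
  also have "\<dots> = (\<Sum>k<L. real (card (T k \<times> T k \<times> T k)) * (2 * exp (- (98 * real N * 4 ^ Suc k))))"
  proof -
    have "(14 * sqrt (real N) * 2 ^ Suc k)\<^sup>2 / 2 = 98 * real N * 4 ^ Suc k" for k
    proof -
      have "(4 :: real) ^ Suc k = (2 ^ Suc k)\<^sup>2" by (simp add: power2_eq_square flip: power_mult_distrib)
      then show ?thesis by (simp only: power_mult_distrib) simp
    qed
    then show ?thesis by (simp only: sum_constant minus_divide_left[symmetric])
  qed
  also have "\<dots> \<le> (\<Sum>k<L. exp (84 * real N * 4 ^ Suc k) * (2 * exp (- (98 * real N * 4 ^ Suc k))))"
    by (intro sum_mono mult_right_mono card) auto
  also have "\<dots> \<le> (\<Sum>k<L. 2 * exp (- 14 * 4 ^ Suc k))"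
  proof (rule sum_mono)
    fix k
    have "exp (84 * real N * 4 ^ Suc k) * (2 * exp (- (98 * real N * 4 ^ Suc k)))
        = 2 * exp (84 * real N * 4 ^ Suc k + - (98 * real N * 4 ^ Suc k))"
      by (simp only: exp_add mult_ac)
    also have "84 * real N * 4 ^ Suc k + - (98 * real N * 4 ^ Suc k) = - 14 * 4 ^ Suc k * real N" by simp
    also have "2 * exp (- 14 * 4 ^ Suc k * real N) \<le> 2 * exp (- 14 * 4 ^ Suc k)"
      using N by simp
    finally show "exp (84 * real N * 4 ^ Suc k) * (2 * exp (- (98 * real N * 4 ^ Suc k))) \<le> 2 * exp (- 14 * 4 ^ Suc k)" .
  qed
  also have "\<dots> < 1" by (rule sum_exp_level_bound)
  finally have ub: "(\<Sum>m\<in>M. 2 * exp (- (s m)\<^sup>2 / 2)) < 1" .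
  obtain \<psi> where \<psi>: "\<forall>p\<in>cube N. \<bar>\<psi> p\<bar> = 1"
    and le: "\<forall>m\<in>M. \<bar>\<Sum>p\<in>cube N. \<psi> p * \<theta> m p\<bar> \<le> s m * L2_set (\<theta> m) (cube N)"
    using signs_exist[OF finite_cube[of N] finM s_nonneg ub, where \<theta> = \<theta>] by blast
  have norm_\<psi>: "L2_set \<psi> (cube N) = real N * sqrt (real N)"
  proof -
    have "(\<psi> p)\<^sup>2 = 1" if "p \<in> cube N" for p
      using bspec[OF \<psi> that] power2_abs[of "\<psi> p"] by simp
    then have "L2_set \<psi> (cube N) = sqrt (real (N ^ 3))"
      by (simp add: L2_set_def card_cube)
    then show ?thesis by (simp add: power3_eq_cube real_sqrt_mult)
  qed
  have "\<bar>\<Sum>p\<in>cube N. \<psi> p * tens_apply N A B C \<phi> p\<bar> \<le> 300000 * real N * (real L + 1)"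
    if hs: "hs_norm N A \<le> 1" "hs_norm N B \<le> 1" "hs_norm N C \<le> 1" for A B C
  proof -
    obtain a where a0: "a 0 = (\<lambda>_ _. 0)" and a: "\<And>k. a k \<in> level_net N k" "\<And>k. hs_norm N (a k) \<le> 2"
        "\<And>k. op_le N (\<lambda>i j. A i j - a k i j) (8 / 2 ^ k)"
      using level_net_sequence[OF hs(1)] by blast
    obtain b where b: "\<And>k. b k \<in> level_net N k" "\<And>k. hs_norm N (b k) \<le> 2"
        "\<And>k. op_le N (\<lambda>i j. B i j - b k i j) (8 / 2 ^ k)"
      using level_net_sequence[OF hs(2)] by blast
    obtain c where c: "\<And>k. c k \<in> level_net N k" "\<And>k. hs_norm N (c k) \<le> 2"
        "\<And>k. op_le N (\<lambda>i j. C i j - c k i j) (8 / 2 ^ k)"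
      using level_net_sequence[OF hs(3)] by blast
    \<comment> \<open>Triangle inequality through the common target \<open>X\<close>: the errors at
      the two levels add up to \<open>(16 + 8) / 2 ^ Suc k\<close>.\<close>
    have diff: "op_le N (\<lambda>i j. x (Suc k) i j - x k i j) (24 / 2 ^ Suc k)"
      if "\<And>k. op_le N (\<lambda>i j. X i j - x k i j) (8 / 2 ^ k)" for X and x :: "nat \<Rightarrow> nat \<Rightarrow> nat \<Rightarrow> real" and k
    proof -
      have "op_le N (\<lambda>i j. (X i j - x k i j) - (X i j - x (Suc k) i j)) (8 / 2 ^ k + 8 / 2 ^ Suc k)"
        by (intro op_le_diff that)
      moreover have "(\<lambda>i j. (X i j - x k i j) - (X i j - x (Suc k) i j)) = (\<lambda>i j. x (Suc k) i j - x k i j)"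
        by (simp add: fun_eq_iff)
      moreover have "8 / 2 ^ k + 8 / 2 ^ Suc k = (24 / 2 ^ Suc k :: real)" by (simp add: field_simps)
      ultimately show ?thesis by simp
    qed
    define F where "F A B C = (\<Sum>p\<in>cube N. \<psi> p * tens_apply N A B C \<phi> p)" for A B C
    have F_diff: "F A B C - F A' B' C' = (\<Sum>p\<in>cube N. \<psi> p * (tens_apply N A B C \<phi> p - tens_apply N A' B' C' \<phi> p))"
      for A B C A' B' C'
      by (simp add: F_def right_diff_distrib sum_subtractf)
    \<comment> \<open>The powers \<open>2 ^ Suc k\<close> in the deviation and in the increment
      cancel, so the bound is the same at each level;
      \<open>225792 = 14 * 12 * 56 * 24\<close>.\<close>
    have step: "\<bar>F (a (Suc k)) (b (Suc k)) (c (Suc k)) - F (a k) (b k) (c k)\<bar> \<le> 225792 * real N" if k: "k < L" for k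
    proof -
      let ?m = "(k, (a (Suc k), a k), (b (Suc k), b k), (c (Suc k), c k))"
      have m: "?m \<in> M" using k a b c by (simp add: M_def T_def)
      have \<theta>m: "\<theta> ?m = (\<lambda>p. tens_apply N (a (Suc k)) (b (Suc k)) (c (Suc k)) \<phi> p - tens_apply N (a k) (b k) (c k) \<phi> p)"
        by (simp add: \<theta>_def)
      have "\<bar>F (a (Suc k)) (b (Suc k)) (c (Suc k)) - F (a k) (b k) (c k)\<bar> \<le> s ?m * L2_set (\<theta> ?m) (cube N)"
        using bspec[OF le m] by (simp add: F_diff \<theta>m)
      also have "\<dots> \<le> s ?m * (12 * (56 * sqrt (real N)) * (24 / 2 ^ Suc k))"
        unfolding \<theta>m
        by (intro mult_left_mono L2_set_tens_apply_diff[OF S] diff[OF a(3)] diff[OF b(3)] diff[OF c(3)] a b c)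
          (auto simp: s_def)
      also have "\<dots> = 225792 * (sqrt (real N) * sqrt (real N))"
        by (simp add: s_def)
      finally show ?thesis by simp
    qed
    \<comment> \<open>The remainder involves all matrices, not finitely many, and is estimated
      without randomness. Cauchy-Schwarz gives order \<open>N ^ 2 / 2 ^ L\<close>, and
      \<open>2 ^ L \<ge> N\<close> brings it down to order \<open>N\<close>;
      \<open>5376 = 12 * 56 * 8\<close>.\<close>
    have last: "\<bar>F A B C - F (a L) (b L) (c L)\<bar> \<le> 5376 * real N"
    proof -
      have "\<bar>F A B C - F (a L) (b L) (c L)\<bar> \<le> L2_set \<psi> (cube N)
          * L2_set (\<lambda>p. tens_apply N A B C \<phi> p - tens_apply N (a L) (b L) (c L) \<phi> p) (cube N)"
        unfolding F_diff by (rule abs_sum_mult_le_L2_set)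
      also have "\<dots> \<le> (real N * sqrt (real N)) * (12 * (56 * sqrt (real N)) * (8 / 2 ^ L))"
        unfolding norm_\<psi>
        by (intro mult_left_mono L2_set_tens_apply_diff[OF S] a b c) (use hs in auto)
      also have "\<dots> = 5376 * real N * (sqrt (real N) * sqrt (real N)) * (1 / 2 ^ L)" by simp
      also have "\<dots> = 5376 * real N * (real N / 2 ^ L)" by simp
      also have "\<dots> \<le> 5376 * real N * 1"
      proof (rule mult_left_mono)
        have "real N \<le> real (2 ^ L)" using L by (simp only: of_nat_le_iff)
        then show "real N / 2 ^ L \<le> 1" by simp
      qed simp
      finally show ?thesis by simp
    qed
    \<comment> \<open>One vanishing factor, \<open>a 0\<close>, is enough for the telescope to start
      at 0.\<close>
    have tel: "F (a L) (b L) (c L) = (\<Sum>k<L. F (a (Suc k)) (b (Suc k)) (c (Suc k)) - F (a k) (b k) (c k))"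
      by (subst sum_lessThan_telescope) (simp add: F_def a0 tens_apply_zero)
    have "\<bar>F (a L) (b L) (c L)\<bar> \<le> (\<Sum>k<L. 225792 * real N)"
      unfolding tel by (rule order_trans[OF sum_abs], rule sum_mono, rule step) simp
    then have "\<bar>F (a L) (b L) (c L)\<bar> \<le> 225792 * real N * real L" by (simp add: mult_ac)
    then have "\<bar>F A B C\<bar> \<le> 225792 * real N * real L + 5376 * real N" using last by linarith
    also have "\<dots> \<le> 300000 * real N * real L + 300000 * real N" by (intro add_mono mult_right_mono) auto
    finally show ?thesis by (simp add: F_def algebra_simps)
  qed
  with \<phi> \<psi> show ?thesis by blast
qed

section \<open>Weyl matrices\<close>

lemma sum_cis_eq_0:
  fixes d :: int
  assumes d: "d \<noteq> 0" "\<bar>d\<bar> < int N"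
  shows "(\<Sum>a<N. cis (2 * pi * (real a * of_int d) / real N)) = 0"
proof -
  define z where "z = cis (2 * pi * of_int d / real N)"
  have N: "N > 0" using d by (cases N) auto
  have "z \<noteq> 1"
  proof
    assume "z = 1"
    then have "cos (2 * pi * of_int d / real N) = 1" unfolding z_def by (simp add: complex_eq_iff)
    then obtain m :: int where "2 * pi * of_int d / real N = of_int m * 2 * pi"
      using cos_one_2pi_int by blast
    then have "of_int d = real_of_int (m * int N)" using N by (simp add: field_simps)
    then have "d = m * int N" by (simp only: of_int_eq_iff)
    with d show False by (cases "m = 0") (auto simp: abs_mult)
  qed
  have "z ^ N = cis (2 * pi * of_int d)"
    unfolding z_def Complex.DeMoivre using N by simp
  also have "\<dots> = 1" by (simp add: cis_conv_exp complex_eq_iff cos_int_2pin sin_int_2pin mult_ac)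
  finally have "z ^ N = 1" .
  have "(\<Sum>a<N. cis (2 * pi * (real a * of_int d) / real N)) = (\<Sum>a<N. z ^ a)"
    unfolding z_def Complex.DeMoivre by (simp add: mult_ac)
  also have "\<dots> = 0" using \<open>z \<noteq> 1\<close> \<open>z ^ N = 1\<close> by (simp add: geometric_sum)
  finally show ?thesis .
qed

lemma sum_cis_diff:
  assumes "q < N" "q' < N"
  shows "(\<Sum>a<N. cis (2 * pi * (real a * real q) / real N) * cnj (cis (2 * pi * (real a * real q') / real N)))
    = (if q = q' then of_nat N else 0)"
proof -
  have "cis (2 * pi * (real a * real q) / real N) * cnj (cis (2 * pi * (real a * real q') / real N))
      = cis (2 * pi * (real a * of_int (int q - int q')) / real N)" for a
    by (simp add: cis_cnj cis_mult diff_divide_distrib algebra_simps)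
  moreover have "int q - int q' \<noteq> 0" "\<bar>int q - int q'\<bar> < int N" if "q \<noteq> q'"
    using that assms by auto
  ultimately show ?thesis using sum_cis_eq_0[of "int q - int q'" N] by (cases "q = q'") (simp_all del: of_int_diff)
qed

lemma add_mod_inj:
  fixes q b b' N :: nat
  assumes "q < N" "b < N" "b' < N" "(q + b) mod N = (q + b') mod N"
  shows "b = b'"
proof -
  have "(q + x) mod N = (if q + x < N then q + x else q + x - N)" if "x < N" for x
    using that assms(1) by (simp add: mod_if)
  then show ?thesis using assms by (auto split: if_splits)
qed

lemma bij_betw_add_mod:
  fixes q N :: nat
  assumes "q < N"
  shows "bij_betw (\<lambda>b. (q + b) mod N) {..<N} {..<N}"
proof -
  have inj: "inj_on (\<lambda>b. (q + b) mod N) {..<N}"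
    by (rule inj_onI) (rule add_mod_inj[OF assms], auto)
  have "(\<lambda>b. (q + b) mod N) ` {..<N} = {..<N}"
    by (rule endo_inj_surj[OF _ _ inj]) (use assms in auto)
  with inj show ?thesis by (rule bij_betw_imageI)
qed

text \<open>A modulation followed by a cyclic shift: the basis vector with index \<open>q\<close> is
  sent to \<open>cis (2 * pi * a * q / N)\<close> times the one with index \<open>q + b\<close>
  modulo \<open>N\<close>.\<close>

definition weyl :: "nat \<Rightarrow> nat \<times> nat \<Rightarrow> nat \<Rightarrow> nat \<Rightarrow> complex"
  where "weyl N = (\<lambda>(a, b) p q. if p = (q + b) mod N then cis (2 * pi * (real a * real q) / real N) else 0)"

text \<open>Different shifts have disjoint supports; for equal shifts it is the orthogonality of the
  characters of the cyclic group.\<close>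

lemma weyl_orthogonal:
  assumes "P \<in> {..<N} \<times> {..<N}" "P' \<in> {..<N} \<times> {..<N}"
  shows "(\<Sum>(p, q)\<in>{..<N} \<times> {..<N}. weyl N P p q * cnj (weyl N P' p q)) = (if P = P' then of_nat N else 0)"
proof -
  obtain a b a' b' where P: "P = (a, b)" "P' = (a', b')" by (cases P, cases P')
  let ?e = "\<lambda>a q. cis (2 * pi * (real a * real q) / real N)"
  have "(\<Sum>(p, q)\<in>{..<N} \<times> {..<N}. weyl N P p q * cnj (weyl N P' p q))
      = (\<Sum>q<N. \<Sum>p<N. weyl N P p q * cnj (weyl N P' p q))"
    by (subst sum.swap) (simp add: sum.cartesian_product)
  also have "\<dots> = (\<Sum>q<N. if b = b' then ?e q a * cnj (?e q a') else 0)"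
  proof (rule sum.cong[OF refl])
    fix q assume q: "q \<in> {..<N}"
    have "(\<Sum>p<N. weyl N P p q * cnj (weyl N P' p q))
        = (\<Sum>p<N. if p = (q + b) mod N then (if (q + b) mod N = (q + b') mod N then ?e q a * cnj (?e q a') else 0) else 0)"
      by (intro sum.cong) (auto simp: weyl_def P mult_ac)
    also have "\<dots> = (if (q + b) mod N = (q + b') mod N then ?e q a * cnj (?e q a') else 0)"
      using q by (subst sum.delta) auto
    also have "(q + b) mod N = (q + b') mod N \<longleftrightarrow> b = b'"
      using add_mod_inj[of q N b b'] q assms by (auto simp: P)
    finally show "(\<Sum>p<N. weyl N P p q * cnj (weyl N P' p q)) = (if b = b' then ?e q a * cnj (?e q a') else 0)" .
  qed
  also have "\<dots> = (if b = b' then (\<Sum>q<N. ?e q a * cnj (?e q a')) else 0)" by simp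
  also have "\<dots> = (if P = P' then of_nat N else 0)"
    using assms by (subst sum_cis_diff) (auto simp: P)
  finally show ?thesis .
qed

text \<open>The same orthogonality read along the other index: the \<open>N\<^sup>2\<close> by
  \<open>N\<^sup>2\<close> array of all entries of all Weyl matrices is \<open>sqrt N\<close> times
  a unitary. Summing over the modulation forces \<open>q = q'\<close>; a common shift then forces
  \<open>p = p'\<close>, and exactly one shift leads from \<open>q\<close> to
  \<open>p\<close>.\<close>

lemma weyl_complete:
  assumes "p < N" "q < N" "p' < N" "q' < N"
  shows "(\<Sum>P\<in>{..<N} \<times> {..<N}. weyl N P p q * cnj (weyl N P p' q')) = (if p = p' \<and> q = q' then of_nat N else 0)"
proof -
  let ?e = "\<lambda>a q. cis (2 * pi * (real a * real q) / real N)"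
  have "(\<Sum>P\<in>{..<N} \<times> {..<N}. weyl N P p q * cnj (weyl N P p' q'))
      = (\<Sum>b<N. \<Sum>a<N. weyl N (a, b) p q * cnj (weyl N (a, b) p' q'))"
    by (subst sum.swap) (simp add: sum.cartesian_product)
  also have "\<dots> = (\<Sum>b<N. if p = (q + b) mod N \<and> p' = (q' + b) mod N then (\<Sum>a<N. ?e a q * cnj (?e a q')) else 0)"
    by (intro sum.cong) (auto simp: weyl_def)
  also have "\<dots> = (\<Sum>b<N. if p = (q + b) mod N \<and> p' = (q' + b) mod N then (if q = q' then of_nat N else 0) else 0)"
    using assms by (subst sum_cis_diff) auto
  also have "\<dots> = (\<Sum>b<N. (\<lambda>r. if p = r \<and> p = p' \<and> q = q' then of_nat N else 0) ((q + b) mod N))"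
    by (intro sum.cong) auto
  also have "\<dots> = (\<Sum>r<N. if p = r \<and> p = p' \<and> q = q' then of_nat N else 0)"
    by (rule sum.reindex_bij_betw[OF bij_betw_add_mod[OF assms(2)]])
  also have "\<dots> = (\<Sum>r<N. if p = r then (if p = p' \<and> q = q' then of_nat N else 0) else 0)"
    by (intro sum.cong) auto
  also have "\<dots> = (if p = p' \<and> q = q' then of_nat N else 0)"
    using assms by (subst sum.delta') auto
  finally show ?thesis .
qed

lemma weyl_columns:
  assumes P: "P \<in> {..<N} \<times> {..<N}" and q: "q < N" "q' < N"
  shows "(\<Sum>p<N. weyl N P p q * cnj (weyl N P p q')) = (if q = q' then 1 else 0)"
proof -
  obtain a b where ab: "P = (a, b)" by (cases P)
  let ?e = "\<lambda>a q. cis (2 * pi * (real a * real q) / real N)"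
  have "(\<Sum>p<N. weyl N P p q * cnj (weyl N P p q'))
      = (\<Sum>p<N. if p = (q + b) mod N then (if (b + q) mod N = (b + q') mod N then ?e a q * cnj (?e a q') else 0) else 0)"
    by (intro sum.cong) (auto simp: weyl_def ab add.commute)
  also have "\<dots> = (if (b + q) mod N = (b + q') mod N then ?e a q * cnj (?e a q') else 0)"
    using q by (subst sum.delta) auto
  also have "\<dots> = (if q = q' then 1 else 0)"
    using add_mod_inj[of b N q q'] P q by (auto simp: ab cis_cnj cis_mult)
  finally show ?thesis .
qed

lemma weyl_rows:
  assumes P: "P \<in> {..<N} \<times> {..<N}" and p: "p < N" "p' < N"
  shows "(\<Sum>q<N. weyl N P p q * cnj (weyl N P p' q)) = (if p = p' then 1 else 0)"
proof -
  obtain a b where ab: "P = (a, b)" by (cases P)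
  have b: "b < N" using P by (simp add: ab)
  have "(\<Sum>q<N. weyl N P p q * cnj (weyl N P p' q))
      = (\<Sum>q<N. (\<lambda>r. if r = p then (if p = p' then 1 else 0) else 0) ((b + q) mod N))"
    by (intro sum.cong) (auto simp: weyl_def ab cis_cnj cis_mult add.commute)
  also have "\<dots> = (\<Sum>r<N. if r = p then (if p = p' then 1 else 0) else 0)"
    by (rule sum.reindex_bij_betw[OF bij_betw_add_mod[OF b]])
  also have "\<dots> = (if p = p' then 1 else 0)" using p by (subst sum.delta) auto
  finally show ?thesis .
qed

text \<open>Used in both directions: with \<open>X\<close> the indices of the unitaries it computes
  the Hilbert-Schmidt norm of a combination of them, and with \<open>X\<close> the pairs of tensor
  positions it computes the square sum of the coefficients.\<close>

lemma sum_Parseval: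
  fixes w :: "'m \<Rightarrow> 'x \<Rightarrow> complex"
  assumes X: "finite X"
    and w: "\<And>x y. x \<in> X \<Longrightarrow> y \<in> X \<Longrightarrow> (\<Sum>m\<in>M. w m x * cnj (w m y)) = (if x = y then c else 0)"
  shows "(\<Sum>m\<in>M. (\<Sum>x\<in>X. f x * w m x) * cnj (\<Sum>x\<in>X. f x * w m x)) = c * (\<Sum>x\<in>X. f x * cnj (f x))"
proof -
  have "(\<Sum>m\<in>M. (\<Sum>x\<in>X. f x * w m x) * cnj (\<Sum>x\<in>X. f x * w m x))
      = (\<Sum>m\<in>M. \<Sum>x\<in>X. \<Sum>y\<in>X. f x * cnj (f y) * (w m x * cnj (w m y)))"
    by (simp add: sum_product cnj_sum mult_ac)
  also have "\<dots> = (\<Sum>x\<in>X. \<Sum>y\<in>X. \<Sum>m\<in>M. f x * cnj (f y) * (w m x * cnj (w m y)))"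
    by (rule sum_rotate3[symmetric])
  also have "\<dots> = (\<Sum>x\<in>X. \<Sum>y\<in>X. if x = y then c * (f x * cnj (f x)) else 0)"
    by (intro sum.cong refl) (auto simp: w mult_ac simp flip: sum_distrib_left)
  also have "\<dots> = c * (\<Sum>x\<in>X. f x * cnj (f x))"
    using X by (simp add: sum.delta' sum_distrib_left)
  finally show ?thesis .
qed

section \<open>From real to complex matrices\<close>

lemma tens_apply_linear1: "tens_apply N (\<lambda>i j. X i j + c * Y i j) B C \<phi> p = tens_apply N X B C \<phi> p + c * tens_apply N Y B C \<phi> p"
  and tens_apply_linear2: "tens_apply N A (\<lambda>i j. X i j + c * Y i j) C \<phi> p = tens_apply N A X C \<phi> p + c * tens_apply N A Y C \<phi> p"
  and tens_apply_linear3: "tens_apply N A B (\<lambda>i j. X i j + c * Y i j) \<phi> p = tens_apply N A B X \<phi> p + c * tens_apply N A B Y \<phi> p"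
  by (cases p; simp add: tens_apply_def algebra_simps sum.distrib sum_distrib_left)+

lemma tens_apply_of_real:
  "tens_apply N (\<lambda>i j. complex_of_real (A i j)) (\<lambda>i j. complex_of_real (B i j)) (\<lambda>i j. complex_of_real (C i j))
    (\<lambda>p. complex_of_real (\<phi> p)) p = complex_of_real (tens_apply N A B C \<phi> p)"
  by (cases p) (simp add: tens_apply_def)

lemma hs_norm_Re_le: "(\<Sum>i<N. \<Sum>j<N. (cmod (A i j))\<^sup>2) \<le> h\<^sup>2 \<Longrightarrow> 0 \<le> h \<Longrightarrow> hs_norm N (\<lambda>i j. Re (A i j)) \<le> h"
  and hs_norm_Im_le: "(\<Sum>i<N. \<Sum>j<N. (cmod (A i j))\<^sup>2) \<le> h\<^sup>2 \<Longrightarrow> 0 \<le> h \<Longrightarrow> hs_norm N (\<lambda>i j. Im (A i j)) \<le> h"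
proof -
  assume h: "(\<Sum>i<N. \<Sum>j<N. (cmod (A i j))\<^sup>2) \<le> h\<^sup>2" "0 \<le> h"
  have "(hs_norm N (\<lambda>i j. Re (A i j)))\<^sup>2 \<le> (\<Sum>i<N. \<Sum>j<N. (cmod (A i j))\<^sup>2)"
    unfolding hs_norm_sq by (intro sum_mono) (simp add: cmod_power2)
  with h show "hs_norm N (\<lambda>i j. Re (A i j)) \<le> h" by (meson order_trans power2_le_imp_le)
  have "(hs_norm N (\<lambda>i j. Im (A i j)))\<^sup>2 \<le> (\<Sum>i<N. \<Sum>j<N. (cmod (A i j))\<^sup>2)"
    unfolding hs_norm_sq by (intro sum_mono) (simp add: cmod_power2)
  with h show "hs_norm N (\<lambda>i j. Im (A i j)) \<le> h" by (meson order_trans power2_le_imp_le)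
qed

text \<open>Splitting each matrix into real and imaginary part gives 8 real trilinear forms, and
  rescaling the three arguments to the unit ball gives \<open>h ^ 3\<close>.\<close>

lemma complex_trilinear_bound:
  fixes A B C :: "nat \<Rightarrow> nat \<Rightarrow> complex" and \<psi> \<phi> :: "nat \<times> nat \<times> nat \<Rightarrow> real"
  assumes real_bound: "\<And>A B C. hs_norm N A \<le> 1 \<Longrightarrow> hs_norm N B \<le> 1 \<Longrightarrow> hs_norm N C \<le> 1 \<Longrightarrow>
      \<bar>\<Sum>p\<in>cube N. \<psi> p * tens_apply N A B C \<phi> p\<bar> \<le> K"
    and h: "0 < h"
    and hs: "(\<Sum>i<N. \<Sum>j<N. (cmod (A i j))\<^sup>2) \<le> h\<^sup>2" "(\<Sum>i<N. \<Sum>j<N. (cmod (B i j))\<^sup>2) \<le> h\<^sup>2"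
      "(\<Sum>i<N. \<Sum>j<N. (cmod (C i j))\<^sup>2) \<le> h\<^sup>2"
  shows "cmod (\<Sum>p\<in>cube N. \<psi> p * tens_apply N A B C (\<lambda>p. complex_of_real (\<phi> p)) p) \<le> 8 * K * h ^ 3"
proof -
  define F where "F A B C = (\<Sum>p\<in>cube N. complex_of_real (\<psi> p) * tens_apply N A B C (\<lambda>p. complex_of_real (\<phi> p)) p)" for A B C
  let ?r = "\<lambda>A i j. complex_of_real (Re (A i j :: complex))" and ?i = "\<lambda>A i j. complex_of_real (Im (A i j :: complex))"
  have lin1: "F (\<lambda>i j. X i j + c * Y i j) B C = F X B C + c * F Y B C" for X Y c B C
    by (simp add: F_def tens_apply_linear1 distrib_left sum.distrib sum_distrib_left mult_ac)
  have lin2: "F A (\<lambda>i j. X i j + c * Y i j) C = F A X C + c * F A Y C" for X Y c A C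
    by (simp add: F_def tens_apply_linear2 distrib_left sum.distrib sum_distrib_left mult_ac)
  have lin3: "F A B (\<lambda>i j. X i j + c * Y i j) = F A B X + c * F A B Y" for X Y c A B
    by (simp add: F_def tens_apply_linear3 distrib_left sum.distrib sum_distrib_left mult_ac)
  have split: "X = (\<lambda>i j. ?r X i j + \<i> * ?i X i j)" for X :: "nat \<Rightarrow> nat \<Rightarrow> complex"
    by (simp add: complex_eq[symmetric])
  have tri: "cmod (x + \<i> * y) \<le> cmod x + cmod y" for x y
    using norm_triangle_ineq[of x "\<i> * y"] by (simp add: norm_mult)
  have real_case: "cmod (F (\<lambda>i j. of_real (A i j)) (\<lambda>i j. of_real (B i j)) (\<lambda>i j. of_real (C i j))) \<le> K * h ^ 3"
    if "hs_norm N A \<le> h" "hs_norm N B \<le> h" "hs_norm N C \<le> h" for A B C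
  proof -
    have scale: "hs_norm N (\<lambda>i j. A i j / h) \<le> 1" if "hs_norm N A \<le> h" for A
    proof -
      have "hs_norm N (\<lambda>i j. A i j / h) = hs_norm N A / h"
        using h by (simp add: hs_norm_def case_prod_unfold divide_inverse L2_set_left_distrib)
      then show ?thesis using that h by simp
    qed
    have "tens_apply N (\<lambda>i j. A i j / h) (\<lambda>i j. B i j / h) (\<lambda>i j. C i j / h) \<phi> p = tens_apply N A B C \<phi> p / h ^ 3" for p
      using h by (cases p) (simp add: tens_apply_def sum_divide_distrib power3_eq_cube)
    then have "\<bar>\<Sum>p\<in>cube N. \<psi> p * (tens_apply N A B C \<phi> p / h ^ 3)\<bar> \<le> K"
      using real_bound[OF scale scale scale, OF that] by simp
    then have "\<bar>\<Sum>p\<in>cube N. \<psi> p * tens_apply N A B C \<phi> p\<bar> / h ^ 3 \<le> K"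
      using h by (simp add: abs_divide flip: sum_divide_distrib)
    then have "\<bar>\<Sum>p\<in>cube N. \<psi> p * tens_apply N A B C \<phi> p\<bar> \<le> K * h ^ 3"
      using h by (simp add: field_simps)
    moreover have "F (\<lambda>i j. of_real (A i j)) (\<lambda>i j. of_real (B i j)) (\<lambda>i j. of_real (C i j))
        = of_real (\<Sum>p\<in>cube N. \<psi> p * tens_apply N A B C \<phi> p)"
      by (simp add: F_def tens_apply_of_real)
    ultimately show ?thesis by (simp only: norm_of_real)
  qed
  have h0: "0 \<le> h" using h by simp
  note re = hs[THEN hs_norm_Re_le, OF h0] and im = hs[THEN hs_norm_Im_le, OF h0]
  have 1: "cmod (F (\<lambda>i j. of_real (X i j)) (\<lambda>i j. of_real (Y i j)) C) \<le> 2 * (K * h ^ 3)"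
    if "hs_norm N X \<le> h" "hs_norm N Y \<le> h" for X Y
    by (subst split[of C], subst lin3, rule order_trans[OF tri])
      (use real_case[OF that re(3)] real_case[OF that im(3)] in linarith)
  have 2: "cmod (F (\<lambda>i j. of_real (X i j)) B C) \<le> 4 * (K * h ^ 3)" if "hs_norm N X \<le> h" for X
    by (subst split[of B], subst lin2, rule order_trans[OF tri])
      (use 1[OF that re(2)] 1[OF that im(2)] in linarith)
  have "cmod (F A B C) \<le> 8 * (K * h ^ 3)"
    by (subst split[of A], subst lin1, rule order_trans[OF tri])
      (use 2[OF re(1)] 2[OF im(1)] in linarith)
  then show ?thesis by (simp add: F_def)
qed

section \<open>Finite-dimensional Hilbert spaces inside the universe\<close>

lemma cring_complex_ring: "cring complex_ring"
proof (rule cringI)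
  show "abelian_group complex_ring"
    by (rule abelian_groupI) (auto simp: complex_ring_def intro: exI[of _ "- x" for x])
  show "Group.comm_monoid complex_ring"
    by (rule comm_monoidI) (auto simp: complex_ring_def)
qed (auto simp: complex_ring_def algebra_simps)

text \<open>\<open>f\<close> encodes coordinate functions as elements of the universe. The cut-off
  outside \<open>J\<close> makes the coordinates of every element of the type, whether or not it is
  in the carrier, a function supported in \<open>J\<close>.\<close>

definition coord :: "(('i \<Rightarrow> complex) \<Rightarrow> 'a) \<Rightarrow> 'i set \<Rightarrow> 'a \<Rightarrow> 'i \<Rightarrow> complex"
  where "coord f J x = (\<lambda>m. if m \<in> J then inv_into UNIV f x m else 0)"

definition vecs :: "'i set \<Rightarrow> ('i \<Rightarrow> complex) set"
  where "vecs J = {v. \<forall>m. m \<notin> J \<longrightarrow> v m = 0}"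

text \<open>The operations are defined through coordinates also off the carrier, because the facts about
  \<open>Metric_space\<close> need a distance that is symmetric and non-negative on the whole type.\<close>

definition coord_space :: "(('i \<Rightarrow> complex) \<Rightarrow> 'a) \<Rightarrow> 'i set \<Rightarrow> 'a inner_product_space"
  where "coord_space f J = \<lparr>carrier = f ` vecs J, mult = (\<lambda>x y. x), one = f (\<lambda>_. 0), zero = f (\<lambda>_. 0),
    add = (\<lambda>x y. f (\<lambda>m. coord f J x m + coord f J y m)),
    smult = (\<lambda>c x. f (\<lambda>m. c * coord f J x m)),
    ip = (\<lambda>x y. \<Sum>m\<in>J. coord f J x m * cnj (coord f J y m))\<rparr>"

definition mat_op :: "(('i \<Rightarrow> complex) \<Rightarrow> 'a) \<Rightarrow> 'i set \<Rightarrow> ('i \<Rightarrow> 'i \<Rightarrow> complex) \<Rightarrow> 'a \<Rightarrow> 'a"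
  where "mat_op f J w x = f (\<lambda>p. if p \<in> J then \<Sum>q\<in>J. w p q * coord f J x q else 0)"

text \<open>Column and row orthonormality together make the conjugate transpose a two-sided inverse
  without a dimension count.\<close>

definition unitary_matrix :: "'i set \<Rightarrow> ('i \<Rightarrow> 'i \<Rightarrow> complex) \<Rightarrow> bool"
  where "unitary_matrix J w \<longleftrightarrow>
    (\<forall>q\<in>J. \<forall>q'\<in>J. (\<Sum>p\<in>J. w p q * cnj (w p q')) = (if q = q' then 1 else 0)) \<and>
    (\<forall>p\<in>J. \<forall>p'\<in>J. (\<Sum>q\<in>J. w p q * cnj (w p' q)) = (if p = p' then 1 else 0))"

context
  fixes f :: "('i \<Rightarrow> complex) \<Rightarrow> 'a" and J :: "'i set"
  assumes inj: "inj f" and J: "finite J"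
begin

private abbreviation "X \<equiv> coord_space f J"
private abbreviation "co \<equiv> coord f J"

lemma coord_outside: "m \<notin> J \<Longrightarrow> co x m = 0"
  by (simp add: coord_def)

lemma coord_f: "v \<in> vecs J \<Longrightarrow> co (f v) = v"
  by (auto simp: coord_def vecs_def inv_f_f[OF inj])

lemma carrier_coord_space: "carrier X = f ` vecs J"
  by (simp add: coord_space_def)

lemma f_coord: "x \<in> carrier X \<Longrightarrow> f (co x) = x"
  by (auto simp: carrier_coord_space coord_f)

lemma f_closed: "v \<in> vecs J \<Longrightarrow> f v \<in> carrier X"
  by (simp add: carrier_coord_space)

lemma coord_inject: "x \<in> carrier X \<Longrightarrow> y \<in> carrier X \<Longrightarrow> co x = co y \<Longrightarrow> x = y"
  by (metis f_coord)

lemma coord_zero: "co \<zero>\<^bsub>X\<^esub> = (\<lambda>_. 0)"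
  by (simp add: coord_space_def coord_f vecs_def)

lemma coord_add: "co (x \<oplus>\<^bsub>X\<^esub> y) = (\<lambda>m. co x m + co y m)"
  by (simp add: coord_space_def coord_f vecs_def coord_outside)

lemma coord_smult: "co (c \<odot>\<^bsub>X\<^esub> x) = (\<lambda>m. c * co x m)"
  by (simp add: coord_space_def coord_f vecs_def coord_outside)

lemma add_closed_coord: "x \<oplus>\<^bsub>X\<^esub> y \<in> carrier X"
  and smult_closed_coord: "c \<odot>\<^bsub>X\<^esub> x \<in> carrier X"
  and zero_closed_coord: "\<zero>\<^bsub>X\<^esub> \<in> carrier X"
  by (auto simp: coord_space_def vecs_def coord_outside)

lemma ip_coord: "ip X x y = (\<Sum>m\<in>J. co x m * cnj (co y m))"
  by (simp add: coord_space_def)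

lemma hnorm_coord: "hnorm X x = L2_set (\<lambda>m. cmod (co x m)) J"
  by (simp add: hnorm_def ip_coord L2_set_def complex_mult_cnj cmod_power2)

lemma abelian_group_coord_space: "abelian_group X"
proof (rule abelian_groupI)
  fix x assume x: "x \<in> carrier X"
  have v: "(\<lambda>m. - co x m) \<in> vecs J" by (simp add: vecs_def coord_outside)
  have "f (\<lambda>m. - co x m) \<oplus>\<^bsub>X\<^esub> x = \<zero>\<^bsub>X\<^esub>"
    by (rule coord_inject) (simp_all add: add_closed_coord zero_closed_coord coord_add coord_zero coord_f[OF v])
  then show "\<exists>y\<in>carrier X. y \<oplus>\<^bsub>X\<^esub> x = \<zero>\<^bsub>X\<^esub>" using f_closed[OF v] by blast
  show "\<zero>\<^bsub>X\<^esub> \<oplus>\<^bsub>X\<^esub> x = x"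
    by (rule coord_inject) (simp_all add: x add_closed_coord coord_add coord_zero)
qed (auto intro!: coord_inject simp: add_closed_coord zero_closed_coord coord_add add_ac)

lemma module_coord_space: "module complex_ring X"
  by (rule moduleI[OF cring_complex_ring abelian_group_coord_space])
    (auto intro!: coord_inject simp: add_closed_coord smult_closed_coord coord_add coord_smult
      complex_ring_def algebra_simps)

text \<open>This holds off the carrier too. The negative is defined by a description that ranges
  over carrier elements; since addition sees only coordinates, exactly one carrier element fits it
  for every \<open>y\<close>.\<close>

lemma coord_a_minus: "co (x \<ominus>\<^bsub>X\<^esub> y) = (\<lambda>m. co x m - co y m)"
proof -
  define z where "z = f (\<lambda>m. - co y m)"
  have v: "(\<lambda>m. - co y m) \<in> vecs J" by (simp add: vecs_def coord_outside)
  have z: "z \<in> carrier X" "co z = (\<lambda>m. - co y m)" using f_closed[OF v] coord_f[OF v] by (simp_all add: z_def)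
  have iff: "y \<oplus>\<^bsub>X\<^esub> u = \<zero>\<^bsub>X\<^esub> \<and> u \<oplus>\<^bsub>X\<^esub> y = \<zero>\<^bsub>X\<^esub> \<longleftrightarrow> u = z" if u: "u \<in> carrier X" for u
  proof
    assume "y \<oplus>\<^bsub>X\<^esub> u = \<zero>\<^bsub>X\<^esub> \<and> u \<oplus>\<^bsub>X\<^esub> y = \<zero>\<^bsub>X\<^esub>"
    then have "co (y \<oplus>\<^bsub>X\<^esub> u) = co \<zero>\<^bsub>X\<^esub>" by simp
    then have "co u = co z" unfolding coord_add coord_zero z fun_eq_iff by (metis add_eq_0_iff)
    then show "u = z" by (rule coord_inject[OF u z(1)])
  next
    assume "u = z"
    then show "y \<oplus>\<^bsub>X\<^esub> u = \<zero>\<^bsub>X\<^esub> \<and> u \<oplus>\<^bsub>X\<^esub> y = \<zero>\<^bsub>X\<^esub>"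
      by (auto intro!: coord_inject simp: add_closed_coord zero_closed_coord coord_add coord_zero z)
  qed
  have "\<ominus>\<^bsub>X\<^esub> y = (THE u. u \<in> carrier X \<and> y \<oplus>\<^bsub>X\<^esub> u = \<zero>\<^bsub>X\<^esub> \<and> u \<oplus>\<^bsub>X\<^esub> y = \<zero>\<^bsub>X\<^esub>)"
    by (simp add: a_inv_def m_inv_def)
  also have "\<dots> = z" using iff z(1) by (intro the_equality) auto
  finally show ?thesis by (simp add: a_minus_def coord_add z)
qed

lemma hdist_coord: "hdist X x y = L2_set (\<lambda>m. cmod (co x m - co y m)) J"
  by (simp add: hdist_def hnorm_coord coord_a_minus)

lemma Metric_space_coord_space: "Metric_space (carrier X) (hdist X)"
proof
  show "hdist X x y = 0 \<longleftrightarrow> x = y" if "x \<in> carrier X" "y \<in> carrier X" for x y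
  proof
    assume "hdist X x y = 0"
    then have "co x m = co y m" for m
      using J by (cases "m \<in> J") (auto simp: hdist_coord L2_set_eq_0_iff coord_outside)
    then show "x = y" using that coord_inject by blast
  qed (simp add: hdist_coord L2_set_def)
  show "hdist X x z \<le> hdist X x y + hdist X y z" for x y z
  proof -
    have "hdist X x z \<le> L2_set (\<lambda>m. cmod (co x m - co y m) + cmod (co y m - co z m)) J"
      unfolding hdist_coord
      by (intro L2_set_mono order_trans[OF _ norm_triangle_ineq]) auto
    also have "\<dots> \<le> hdist X x y + hdist X y z" unfolding hdist_coord by (rule L2_set_triangle_ineq)
    finally show ?thesis .
  qed
qed (auto simp: hdist_coord norm_minus_commute)

lemma mcomplete_coord_space: "Metric_space.mcomplete (carrier X) (hdist X)"
  unfolding Metric_space.mcomplete_def[OF Metric_space_coord_space]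
proof (intro allI impI)
  fix \<sigma> assume cau: "Metric_space.MCauchy (carrier X) (hdist X) \<sigma>"
  have mem: "\<sigma> n \<in> carrier X" for n
    using cau unfolding Metric_space.MCauchy_def[OF Metric_space_coord_space] by auto
  have comp: "cmod (co x m - co y m) \<le> hdist X x y" if "m \<in> J" for m x y
    unfolding hdist_coord by (rule member_le_L2_set[OF J that])
  have "Cauchy (\<lambda>n. co (\<sigma> n) m)" if m: "m \<in> J" for m
  proof (rule CauchyI)
    fix e :: real assume "0 < e"
    then obtain n0 where "\<And>n n'. n0 \<le> n \<Longrightarrow> n0 \<le> n' \<Longrightarrow> hdist X (\<sigma> n) (\<sigma> n') < e"
      using cau unfolding Metric_space.MCauchy_def[OF Metric_space_coord_space] by blast
    then show "\<exists>M. \<forall>i\<ge>M. \<forall>n\<ge>M. cmod (co (\<sigma> i) m - co (\<sigma> n) m) < e"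
      using order.strict_trans1[OF comp[OF m]] by blast
  qed
  then have lim: "(\<lambda>n. co (\<sigma> n) m) \<longlonglongrightarrow> lim (\<lambda>n. co (\<sigma> n) m)" if "m \<in> J" for m
    using that Cauchy_convergent convergent_LIMSEQ_iff by blast
  define v where "v m = (if m \<in> J then lim (\<lambda>n. co (\<sigma> n) m) else 0)" for m
  have v: "v \<in> vecs J" by (simp add: vecs_def v_def)
  have "(\<lambda>n. sqrt (\<Sum>m\<in>J. (cmod (co (\<sigma> n) m - v m))\<^sup>2)) \<longlonglongrightarrow> sqrt (\<Sum>m\<in>J. (cmod (v m - v m))\<^sup>2)"
    by (intro tendsto_intros) (simp add: v_def lim)
  then have conv: "(\<lambda>n. hdist X (\<sigma> n) (f v)) \<longlonglongrightarrow> 0"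
    by (simp add: hdist_coord L2_set_def coord_f[OF v])
  have "\<exists>n0. \<forall>n\<ge>n0. \<sigma> n \<in> carrier X \<and> hdist X (\<sigma> n) (f v) < e" if "0 < e" for e
    using order_tendstoD(2)[OF conv that] mem unfolding eventually_sequentially by simp
  then have "limitin (Metric_space.mtopology (carrier X) (hdist X)) \<sigma> (f v) sequentially"
    unfolding Metric_space.limit_metric_sequentially[OF Metric_space_coord_space] using f_closed[OF v] by blast
  then show "\<exists>x. limitin (Metric_space.mtopology (carrier X) (hdist X)) \<sigma> x sequentially" ..
qed

lemma hilbert_space_coord_space: "hilbert_space X"
proof (intro hilbert_space.intro hilbert_space_axioms.intro module_coord_space mcomplete_coord_space)
  fix x y z c
  assume x: "x \<in> carrier X"
  show "ip X (x \<oplus>\<^bsub>X\<^esub> y) z = ip X x z + ip X y z"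
    by (simp add: ip_coord coord_add distrib_right sum.distrib)
  show "ip X (c \<odot>\<^bsub>X\<^esub> x) y = c * ip X x y"
    by (simp add: ip_coord coord_smult sum_distrib_left mult.assoc)
  show "ip X y x = cnj (ip X x y)"
    by (simp add: ip_coord cnj_sum mult.commute)
  have sq: "ip X x x = of_real (\<Sum>m\<in>J. (cmod (co x m))\<^sup>2)"
    unfolding ip_coord of_real_sum complex_norm_square ..
  show "0 \<le> Re (ip X x x)" by (simp add: sq sum_nonneg)
  assume "ip X x x = 0"
  then have "(\<Sum>m\<in>J. (cmod (co x m))\<^sup>2) = 0" using sq by (metis of_real_eq_0_iff)
  then have "co x m = 0" for m using J by (cases "m \<in> J") (auto simp: sum_nonneg_eq_0_iff coord_outside)
  then show "x = \<zero>\<^bsub>X\<^esub>" by (intro coord_inject x zero_closed_coord) (auto simp: coord_zero)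
qed

lemma coord_finsum:
  assumes "finite A" "\<And>a. a \<in> A \<Longrightarrow> g a \<in> carrier X"
  shows "co (\<Oplus>\<^bsub>X\<^esub>a\<in>A. g a) = (\<lambda>m. \<Sum>a\<in>A. co (g a) m)"
  using assms
proof (induction A rule: finite_induct)
  case empty
  show ?case by (simp add: abelian_monoid.finsum_empty[OF abelian_group.axioms(1)[OF abelian_group_coord_space]] coord_zero)
next
  case (insert a A)
  then show ?case
    by (simp add: abelian_monoid.finsum_insert[OF abelian_group.axioms(1)[OF abelian_group_coord_space]] coord_add Pi_def)
qed

lemma finsum_closed_coord: "(\<And>a. a \<in> A \<Longrightarrow> g a \<in> carrier X) \<Longrightarrow> (\<Oplus>\<^bsub>X\<^esub>a\<in>A. g a) \<in> carrier X"
  by (intro abelian_monoid.finsum_closed[OF abelian_group.axioms(1)[OF abelian_group_coord_space]]) auto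

lemma mat_op_closed: "mat_op f J w x \<in> carrier X"
  unfolding mat_op_def by (intro f_closed) (simp add: vecs_def)

lemma coord_mat_op: "co (mat_op f J w x) = (\<lambda>p. if p \<in> J then \<Sum>q\<in>J. w p q * co x q else 0)"
  unfolding mat_op_def by (rule coord_f) (simp add: vecs_def)

lemma bounded_operator_mat_op: "bounded_operator X (mat_op f J w)"
  unfolding bounded_operator_def
proof (intro conjI ballI allI exI)
  fix x
  have "hnorm X (mat_op f J w x) \<le> (\<Sum>p\<in>J. cmod (\<Sum>q\<in>J. w p q * co x q))"
    unfolding hnorm_coord coord_mat_op by (rule order_trans[OF L2_set_le_sum_abs]) simp
  also have "\<dots> \<le> (\<Sum>p\<in>J. \<Sum>q\<in>J. cmod (w p q) * hnorm X x)"
    using member_le_L2_set[OF J, of _ "\<lambda>m. cmod (co x m)"]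
    by (intro sum_mono order_trans[OF norm_sum]) (auto simp: norm_mult hnorm_coord intro: mult_left_mono)
  finally show "hnorm X (mat_op f J w x) \<le> (\<Sum>p\<in>J. \<Sum>q\<in>J. cmod (w p q)) * hnorm X x"
    by (simp add: sum_distrib_right)
qed (auto intro!: coord_inject simp: mat_op_closed add_closed_coord smult_closed_coord coord_mat_op coord_add
    coord_smult fun_eq_iff distrib_left sum.distrib sum_distrib_left mult_ac)

lemma mat_op_inverse:
  assumes w: "\<And>p r. p \<in> J \<Longrightarrow> r \<in> J \<Longrightarrow> (\<Sum>q\<in>J. w p q * w' q r) = (if p = r then 1 else 0)"
    and x: "x \<in> carrier X"
  shows "mat_op f J w (mat_op f J w' x) = x"
proof (rule coord_inject[OF mat_op_closed x])
  have "(\<Sum>q\<in>J. w p q * (\<Sum>r\<in>J. w' q r * co x r)) = co x p" if p: "p \<in> J" for p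
  proof -
    have "(\<Sum>q\<in>J. w p q * (\<Sum>r\<in>J. w' q r * co x r)) = (\<Sum>r\<in>J. (\<Sum>q\<in>J. w p q * w' q r) * co x r)"
      unfolding sum_distrib_left sum_distrib_right by (subst sum.swap) (simp add: mult.assoc)
    also have "\<dots> = (\<Sum>r\<in>J. if p = r then co x r else 0)"
      by (intro sum.cong) (auto simp: w p)
    also have "\<dots> = co x p" using J p by (simp add: sum.delta')
    finally show ?thesis .
  qed
  then show "co (mat_op f J w (mat_op f J w' x)) = co x"
    by (auto simp: coord_mat_op fun_eq_iff coord_outside)
qed

lemma unitary_operator_mat_op:
  assumes w: "unitary_matrix J w"
  shows "unitary_operator X (mat_op f J w)"
  unfolding unitary_operator_def
proof (intro conjI ballI bounded_operator_mat_op)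
  let ?w = "\<lambda>p q. cnj (w q p)"
  have 1: "(\<Sum>q\<in>J. w p q * ?w q r) = (if p = r then 1 else 0)" if "p \<in> J" "r \<in> J" for p r
    using w that by (simp add: unitary_matrix_def)
  have 2: "(\<Sum>q\<in>J. ?w p q * w q r) = (if p = r then 1 else 0)" if "p \<in> J" "r \<in> J" for p r
    using w that by (simp add: unitary_matrix_def mult.commute)
  show "bij_betw (mat_op f J w) (carrier X) (carrier X)"
    by (rule bij_betw_byWitness[where f' = "mat_op f J ?w"])
      (auto simp: mat_op_inverse[OF 1] mat_op_inverse[OF 2] mat_op_closed)
  fix x y
  have "ip X (mat_op f J w x) (mat_op f J w y) = (\<Sum>p\<in>J. \<Sum>q\<in>J. \<Sum>r\<in>J. co x q * cnj (co y r) * (w p q * cnj (w p r)))"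
    by (simp add: ip_coord coord_mat_op cnj_sum sum_product mult_ac)
  also have "\<dots> = (\<Sum>q\<in>J. \<Sum>r\<in>J. \<Sum>p\<in>J. co x q * cnj (co y r) * (w p q * cnj (w p r)))"
    by (rule sum_rotate3[symmetric])
  also have "\<dots> = (\<Sum>q\<in>J. \<Sum>r\<in>J. if q = r then co x q * cnj (co y r) else 0)"
    using w by (intro sum.cong refl) (simp add: unitary_matrix_def flip: sum_distrib_left)
  also have "\<dots> = ip X x y" using J by (simp add: ip_coord sum.delta')
  finally show "ip X (mat_op f J w x) (mat_op f J w y) = ip X x y" .
qed

end

section \<open>The triple tensor product in coordinates\<close>

definition kron3 :: "(nat \<Rightarrow> nat \<Rightarrow> complex) \<Rightarrow> (nat \<Rightarrow> nat \<Rightarrow> complex) \<Rightarrow> (nat \<Rightarrow> nat \<Rightarrow> complex) \<Rightarrow>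
    nat \<times> nat \<times> nat \<Rightarrow> nat \<times> nat \<times> nat \<Rightarrow> complex"
  where "kron3 u v w = (\<lambda>(i, j, k) (i', j', k'). u i i' * v j j' * w k k')"

definition tensor_vec :: "((nat \<Rightarrow> complex) \<Rightarrow> 'a) \<Rightarrow> ((nat \<times> nat \<times> nat \<Rightarrow> complex) \<Rightarrow> 'a) \<Rightarrow> nat \<Rightarrow>
    'a \<Rightarrow> 'a \<Rightarrow> 'a \<Rightarrow> 'a"
  where "tensor_vec f g N x y z =
    g (\<lambda>(i, j, k). coord f {..<N} x i * coord f {..<N} y j * coord f {..<N} z k)"

lemma sum_cube_product: "(\<Sum>(i, j, k)\<in>cube N. a i * b j * c k) = (\<Sum>i<N. a i) * (\<Sum>j<N. b j) * (\<Sum>k<N. c k)"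
  for a :: "nat \<Rightarrow> 'a :: comm_semiring_1"
  unfolding sum_cube by (simp flip: sum_distrib_left sum_distrib_right)

context
  fixes f :: "(nat \<Rightarrow> complex) \<Rightarrow> 'a" and g :: "(nat \<times> nat \<times> nat \<Rightarrow> complex) \<Rightarrow> 'a" and N :: nat
  assumes f: "inj f" and g: "inj g"
begin

private abbreviation "HN \<equiv> coord_space f {..<N}"
private abbreviation "KN \<equiv> coord_space g (cube N)"
private abbreviation "cH \<equiv> coord f {..<N}"
private abbreviation "cK \<equiv> coord g (cube N)"

private lemmas H_facts = coord_add[OF f finite_lessThan[of N]] coord_smult[OF f finite_lessThan[of N]] coord_outside[OF f finite_lessThan[of N]]
private lemmas K_facts = coord_add[OF g finite_cube[of N]] coord_smult[OF g finite_cube[of N]] coord_outside[OF g finite_cube[of N]]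
private lemmas K_inject = coord_inject[OF g finite_cube[of N]]

lemma coord_tensor_vec: "cK (tensor_vec f g N x y z) = (\<lambda>(i, j, k). cH x i * cH y j * cH z k)"
  unfolding tensor_vec_def
  by (rule coord_f[OF g finite_cube[of N]]) (auto simp: vecs_def cube_def H_facts)

lemma tensor_vec_closed: "tensor_vec f g N x y z \<in> carrier KN"
  unfolding tensor_vec_def
  by (rule f_closed[OF g finite_cube[of N]]) (auto simp: vecs_def cube_def H_facts)

text \<open>The basis expansion of \<open>\<xi>\<close>, with each coefficient put into the first
  leg. Elementary tensors thus represent every vector exactly, and the density condition holds with
  distance 0.\<close>

lemma sum_tensor_vec_basis:
  assumes \<xi>: "\<xi> \<in> carrier KN" and h: "bij_betw h {..<M :: nat} (cube N)"
  shows "(\<Oplus>\<^bsub>KN\<^esub>l\<in>{..<M}. tensor_vec f g N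
      (f (\<lambda>i. if i = fst (h l) then cK \<xi> (h l) else 0)) (f (\<lambda>j. if j = fst (snd (h l)) then 1 else 0))
      (f (\<lambda>k. if k = snd (snd (h l)) then 1 else 0))) = \<xi>" (is "finsum KN ?T _ = \<xi>")
proof (rule K_inject)
  have hl: "h l \<in> cube N" if "l < M" for l using h that by (auto simp: bij_betw_def)
  show "finsum KN ?T {..<M} \<in> carrier KN"
    by (intro finsum_closed_coord[OF g finite_cube[of N]] tensor_vec_closed)
  have T: "cK (?T l) p = (if p = h l then cK \<xi> p else 0)" if "l < M" for l p
  proof -
    obtain i j k where hi: "h l = (i, j, k)" by (cases "h l")
    have "i < N" "j < N" "k < N" using hl[OF that] hi by (auto simp: cube_def)
    then have "(\<lambda>i'. if i' = i then cK \<xi> (h l) else 0) \<in> vecs {..<N}" "(\<lambda>j'. if j' = j then 1 else 0) \<in> vecs {..<N}"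
      "(\<lambda>k'. if k' = k then 1 else 0) \<in> vecs {..<N}"
      by (auto simp: vecs_def)
    note this[THEN coord_f[OF f finite_lessThan[of N]]]
    then show ?thesis
      by (cases p) (simp add: coord_tensor_vec hi)
  qed
  have "cK (finsum KN ?T {..<M}) p = cK \<xi> p" for p
  proof -
    have "cK (finsum KN ?T {..<M}) p = (\<Sum>l<M. cK (?T l) p)"
      by (subst coord_finsum[OF g finite_cube[of N]]) (auto simp: tensor_vec_closed)
    also have "\<dots> = (\<Sum>l<M. (\<lambda>q. if p = q then cK \<xi> p else 0) (h l))"
      by (intro sum.cong) (simp_all add: T)
    also have "\<dots> = (\<Sum>q\<in>cube N. if p = q then cK \<xi> p else 0)"
      by (rule sum.reindex_bij_betw[OF h])
    also have "\<dots> = cK \<xi> p"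
      by (simp add: K_facts)
    finally show ?thesis .
  qed
  then show "cK (finsum KN ?T {..<M}) = cK \<xi>" by blast
qed (rule \<xi>)

lemma hilbert_tensor3_coord_space: "hilbert_tensor3 HN KN (tensor_vec f g N)"
proof (intro hilbert_tensor3.intro hilbert_tensor3_axioms.intro)
  fix x y z x' y' z'
  show "ip KN (tensor_vec f g N x y z) (tensor_vec f g N x' y' z') = ip HN x x' * ip HN y y' * ip HN z z'"
    unfolding ip_coord[OF f finite_lessThan[of N]] ip_coord[OF g finite_cube[of N]] sum_cube_product[symmetric] coord_tensor_vec
    by (intro sum.cong) (auto simp: mult_ac)
next
  fix \<xi> :: 'a and e :: real
  assume \<xi>: "\<xi> \<in> carrier KN" and e: "0 < e"
  obtain h where h: "bij_betw h {..<card (cube N)} (cube N)"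
    using ex_bij_betw_nat_finite[OF finite_cube] by (auto simp: atLeast0LessThan)
  have hl: "h l \<in> cube N" if "l < card (cube N)" for l using h that by (auto simp: bij_betw_def)
  have mem: "f (\<lambda>i. if i = i0 then c else 0) \<in> carrier HN" if "i0 < N" for i0 c
    using that by (intro f_closed[OF f finite_lessThan[of N]]) (auto simp: vecs_def)
  have lt: "fst (h l) < N" "fst (snd (h l)) < N" "snd (snd (h l)) < N" if "l < card (cube N)" for l
    using hl[OF that] by (auto simp: cube_def)
  have "hdist KN \<xi> \<xi> < e" using e by (simp add: hdist_coord[OF g finite_cube[of N]] L2_set_def)
  then show "\<exists>(M::nat) x y z. x \<in> {..<M} \<rightarrow> carrier HN \<and> y \<in> {..<M} \<rightarrow> carrier HN \<and> z \<in> {..<M} \<rightarrow> carrier HN \<and>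
      hdist KN \<xi> (\<Oplus>\<^bsub>KN\<^esub>l\<in>{..<M}. tensor_vec f g N (x l) (y l) (z l)) < e"
    by (intro exI[of _ "card (cube N)"] exI[of _ "\<lambda>l. f (\<lambda>i. if i = fst (h l) then cK \<xi> (h l) else 0)"]
        exI[of _ "\<lambda>l. f (\<lambda>j. if j = fst (snd (h l)) then 1 else 0)"]
        exI[of _ "\<lambda>l. f (\<lambda>k. if k = snd (snd (h l)) then 1 else 0)"])
      (auto simp: sum_tensor_vec_basis[OF \<xi> h] intro!: mem lt)
qed (auto intro!: K_inject hilbert_space_coord_space f g simp: tensor_vec_closed add_closed_coord[OF g finite_cube[of N]]
    smult_closed_coord[OF g finite_cube[of N]] coord_tensor_vec H_facts K_facts algebra_simps)

lemma is_tensor_operator_mat_op: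
  "is_tensor_operator HN KN (tensor_vec f g N) (mat_op f {..<N} u) (mat_op f {..<N} v) (mat_op f {..<N} w)
    (mat_op g (cube N) (kron3 u v w))"
  unfolding is_tensor_operator_def
proof (intro conjI ballI bounded_operator_mat_op[OF g finite_cube[of N]])
  fix x y z
  show "mat_op g (cube N) (kron3 u v w) (tensor_vec f g N x y z)
      = tensor_vec f g N (mat_op f {..<N} u x) (mat_op f {..<N} v y) (mat_op f {..<N} w z)"
  proof (rule K_inject[OF mat_op_closed[OF g finite_cube[of N]] tensor_vec_closed], rule ext)
    fix p :: "nat \<times> nat \<times> nat"
    obtain i j k where p: "p = (i, j, k)" by (cases p)
    have "(\<Sum>q\<in>cube N. kron3 u v w p q * cK (tensor_vec f g N x y z) q)
        = (\<Sum>(i', j', k')\<in>cube N. (u i i' * cH x i') * (v j j' * cH y j') * (w k k' * cH z k'))"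
      by (intro sum.cong) (auto simp: p kron3_def coord_tensor_vec)
    then show "cK (mat_op g (cube N) (kron3 u v w) (tensor_vec f g N x y z)) p
        = cK (tensor_vec f g N (mat_op f {..<N} u x) (mat_op f {..<N} v y) (mat_op f {..<N} w z)) p"
      unfolding sum_cube_product coord_mat_op[OF g finite_cube[of N]] coord_tensor_vec coord_mat_op[OF f finite_lessThan[of N]]
      by (auto simp: p cube_def)
  qed
qed

text \<open>A single matrix coefficient bounds the operator norm, by Cauchy-Schwarz. The pairing
  with \<open>\<zeta>\<close> is bilinear, hence without conjugation, and one family of unitaries
  serves all three legs.\<close>

lemma min_norm_ge:
  assumes u: "\<And>i. i \<in> {1..n} \<Longrightarrow> unitary_matrix {..<N} (u i)"
    and \<eta>: "L2_set (\<lambda>p. cmod (\<eta> p)) (cube N) = 1" and \<zeta>: "L2_set (\<lambda>p. cmod (\<zeta> p)) (cube N) = 1"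
  shows "ereal (cmod (\<Sum>i=1..n. \<Sum>j=1..n. \<Sum>k=1..n. t i j k *
      (\<Sum>p\<in>cube N. \<Sum>q\<in>cube N. \<zeta> p * kron3 (u i) (u j) (u k) p q * \<eta> q))) \<le> min_norm TYPE('a) n t"
proof -
  define U where "U i = mat_op f {..<N} (u i)" for i
  define W where "W i j k = mat_op g (cube N) (kron3 (u i) (u j) (u k))" for i j k
  define T where "T \<xi> = (\<Oplus>\<^bsub>KN\<^esub>i\<in>{1..n}. \<Oplus>\<^bsub>KN\<^esub>j\<in>{1..n}. \<Oplus>\<^bsub>KN\<^esub>k\<in>{1..n}. t i j k \<odot>\<^bsub>KN\<^esub> W i j k \<xi>)" for \<xi>
  define \<xi> where "\<xi> = g (\<lambda>p. if p \<in> cube N then \<eta> p else 0)"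
  have v: "(\<lambda>p. if p \<in> cube N then \<eta> p else 0) \<in> vecs (cube N)" by (simp add: vecs_def)
  have \<xi>: "\<xi> \<in> carrier KN" "cK \<xi> = (\<lambda>p. if p \<in> cube N then \<eta> p else 0)"
    unfolding \<xi>_def by (rule f_closed[OF g finite_cube[of N] v], rule coord_f[OF g finite_cube[of N] v])
  have norm_\<xi>: "hnorm KN \<xi> \<le> 1"
  proof -
    have "hnorm KN \<xi> = L2_set (\<lambda>p. cmod (\<eta> p)) (cube N)"
      unfolding hnorm_coord[OF g finite_cube[of N]] \<xi>(2) by (intro L2_set_cong) auto
    then show ?thesis using \<eta> by simp
  qed
  have coord_T: "cK (T \<xi>) p = (\<Sum>i=1..n. \<Sum>j=1..n. \<Sum>k=1..n. t i j k * (\<Sum>q\<in>cube N. kron3 (u i) (u j) (u k) p q * \<eta> q))"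
    if p: "p \<in> cube N" for p
    unfolding T_def using p
    by (simp add: coord_finsum[OF g finite_cube[of N]] finsum_closed_coord[OF g finite_cube[of N]]
        smult_closed_coord[OF g finite_cube[of N]] K_facts W_def coord_mat_op[OF g finite_cube[of N]] \<xi>)
  have "(\<Sum>i=1..n. \<Sum>j=1..n. \<Sum>k=1..n. t i j k * (\<Sum>p\<in>cube N. \<Sum>q\<in>cube N. \<zeta> p * kron3 (u i) (u j) (u k) p q * \<eta> q))
      = (\<Sum>i=1..n. \<Sum>j=1..n. \<Sum>k=1..n. \<Sum>p\<in>cube N. \<zeta> p * (t i j k * (\<Sum>q\<in>cube N. kron3 (u i) (u j) (u k) p q * \<eta> q)))"
    by (simp add: sum_distrib_left mult_ac)
  also have "\<dots> = (\<Sum>i=1..n. \<Sum>p\<in>cube N. \<Sum>j=1..n. \<Sum>k=1..n. \<zeta> p * (t i j k * (\<Sum>q\<in>cube N. kron3 (u i) (u j) (u k) p q * \<eta> q)))"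
    by (intro sum.cong refl sum_rotate3)
  also have "\<dots> = (\<Sum>p\<in>cube N. \<Sum>i=1..n. \<Sum>j=1..n. \<Sum>k=1..n. \<zeta> p * (t i j k * (\<Sum>q\<in>cube N. kron3 (u i) (u j) (u k) p q * \<eta> q)))"
    by (rule sum.swap)
  also have "\<dots> = (\<Sum>p\<in>cube N. \<zeta> p * cK (T \<xi>) p)"
    by (intro sum.cong refl) (simp add: coord_T sum_distrib_left)
  also have "cmod \<dots> \<le> (\<Sum>p\<in>cube N. \<bar>cmod (\<zeta> p)\<bar> * \<bar>cmod (cK (T \<xi>) p)\<bar>)"
    by (intro order_trans[OF norm_sum]) (simp add: norm_mult)
  also have "\<dots> \<le> L2_set (\<lambda>p. cmod (\<zeta> p)) (cube N) * L2_set (\<lambda>p. cmod (cK (T \<xi>) p)) (cube N)"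
    by (rule L2_set_mult_ineq)
  also have "\<dots> = hnorm KN (T \<xi>)"
    by (simp add: \<zeta> hnorm_coord[OF g finite_cube[of N]])
  finally have "ereal (cmod (\<Sum>i=1..n. \<Sum>j=1..n. \<Sum>k=1..n. t i j k *
      (\<Sum>p\<in>cube N. \<Sum>q\<in>cube N. \<zeta> p * kron3 (u i) (u j) (u k) p q * \<eta> q))) \<le> ereal (hnorm KN (T \<xi>))"
    by (simp only: ereal_less_eq)
  also have "\<dots> \<le> operator_norm KN T"
    unfolding operator_norm_def using \<xi>(1) norm_\<xi> by (intro SUP_upper) auto
  also have "\<dots> \<le> min_norm TYPE('a) n t"
    unfolding min_norm_def T_def
  proof (intro Sup_upper CollectI exI conjI ballI)
    show "hilbert_space HN" by (rule hilbert_space_coord_space[OF f finite_lessThan[of N]])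
    show "hilbert_tensor3 HN KN (tensor_vec f g N)" by (rule hilbert_tensor3_coord_space)
    show "unitary_operator HN (U i)" if "i \<in> {1..n}" for i
      unfolding U_def by (rule unitary_operator_mat_op[OF f finite_lessThan[of N] u[OF that]])
    then show "unitary_operator HN (U i)" "unitary_operator HN (U i)" if "i \<in> {1..n}" for i using that by auto
    show "is_tensor_operator HN KN (tensor_vec f g N) (U i) (U j) (U k) (W i j k)" for i j k
      unfolding U_def W_def by (rule is_tensor_operator_mat_op)
  qed (rule refl)
  finally show ?thesis .
qed

end

section \<open>The lower bound\<close>

text \<open>The Weyl matrices renumbered by \<open>{1..N\<^sup>2}\<close>. Unitarity makes them
  admissible for the minimal norm, orthogonality serves the upper bound for \<open>vee_norm\<close>,
  and completeness the square sum of the coefficients.\<close>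

lemma exists_unitary_basis:
  "\<exists>V :: nat \<Rightarrow> nat \<Rightarrow> nat \<Rightarrow> complex. (\<forall>i\<in>{1..N\<^sup>2}. unitary_matrix {..<N} (V i)) \<and>
    (\<forall>i\<in>{1..N\<^sup>2}. \<forall>i'\<in>{1..N\<^sup>2}.
      (\<Sum>(p, q)\<in>{..<N} \<times> {..<N}. V i p q * cnj (V i' p q)) = (if i = i' then of_nat N else 0)) \<and>
    (\<forall>p<N. \<forall>q<N. \<forall>p'<N. \<forall>q'<N.
      (\<Sum>i=1..N\<^sup>2. V i p q * cnj (V i p' q')) = (if p = p' \<and> q = q' then of_nat N else 0))"
proof -
  have "card {1..N\<^sup>2} = card ({..<N} \<times> {..<N})" by (simp add: power2_eq_square)
  then obtain h where h: "bij_betw h {1..N\<^sup>2} ({..<N} \<times> {..<N})"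
    using finite_same_card_bij[of "{1..N\<^sup>2}" "{..<N} \<times> {..<N}"] by auto
  have mem: "h i \<in> {..<N} \<times> {..<N}" if "i \<in> {1..N\<^sup>2}" for i
    using h that by (metis bij_betwE)
  show ?thesis
  proof (intro exI[of _ "\<lambda>i. weyl N (h i)"] conjI ballI allI impI)
    show "unitary_matrix {..<N} (weyl N (h i))" if "i \<in> {1..N\<^sup>2}" for i
      using weyl_columns[OF mem[OF that]] weyl_rows[OF mem[OF that]] by (simp add: unitary_matrix_def)
    show "(\<Sum>(p, q)\<in>{..<N} \<times> {..<N}. weyl N (h i) p q * cnj (weyl N (h i') p q)) = (if i = i' then of_nat N else 0)"
      if "i \<in> {1..N\<^sup>2}" "i' \<in> {1..N\<^sup>2}" for i i'
      using weyl_orthogonal[OF mem[OF that(1)] mem[OF that(2)]] inj_on_eq_iff[OF bij_betw_imp_inj_on[OF h] that] by simp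
    show "(\<Sum>i=1..N\<^sup>2. weyl N (h i) p q * cnj (weyl N (h i) p' q')) = (if p = p' \<and> q = q' then of_nat N else 0)"
      if "p < N" "q < N" "p' < N" "q' < N" for p q p' q'
      using sum.reindex_bij_betw[OF h, of "\<lambda>P. weyl N P p q * cnj (weyl N P p' q')"] weyl_complete[OF that] by simp
  qed
qed

lemma sum_kron3:
  "(\<Sum>i\<in>I. \<Sum>j\<in>I. \<Sum>k\<in>I. x i * y j * z k * kron3 (V i) (V j) (V k) p q)
    = kron3 (\<lambda>p q. \<Sum>i\<in>I. x i * V i p q) (\<lambda>p q. \<Sum>j\<in>I. y j * V j p q) (\<lambda>p q. \<Sum>k\<in>I. z k * V k p q) p q"
proof -
  obtain p1 p2 p3 q1 q2 q3 where pq: "p = (p1, p2, p3)" "q = (q1, q2, q3)" by (cases p, cases q)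
  have "(\<Sum>i\<in>I. \<Sum>j\<in>I. \<Sum>k\<in>I. (x i * V i p1 q1) * (y j * V j p2 q2) * (z k * V k p3 q3))
      = (\<Sum>i\<in>I. x i * V i p1 q1) * (\<Sum>j\<in>I. y j * V j p2 q2) * (\<Sum>k\<in>I. z k * V k p3 q3)"
    by (simp flip: sum_distrib_left sum_distrib_right)
  then show ?thesis by (simp add: pq kron3_def mult_ac)
qed

lemma tens_apply_kron3: "tens_apply N A B C \<phi> p = (\<Sum>q\<in>cube N. kron3 A B C p q * \<phi> q)"
  by (cases p) (simp add: tens_apply_def sum_cube kron3_def)

lemma unitary_matrix_cnj: "unitary_matrix J w \<Longrightarrow> unitary_matrix J (\<lambda>p q. cnj (w p q))"
proof -
  have *: "(\<Sum>p\<in>J. cnj (a p) * b p) = c" if "(\<Sum>p\<in>J. a p * cnj (b p)) = c" "c \<in> \<real>" for a b :: "'a \<Rightarrow> complex" and c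
    using arg_cong[OF that(1), of cnj] that(2) by (simp add: cnj_sum Reals_cnj_iff)
  assume "unitary_matrix J w"
  then show ?thesis unfolding unitary_matrix_def by (auto intro!: *)
qed

lemma unitary_matrix_one: "finite J \<Longrightarrow> unitary_matrix J (\<lambda>p q. if p = q then 1 else 0)"
proof -
  assume J: "finite J"
  have "(\<Sum>p\<in>J. (if p = q then 1 else 0) * cnj (if p = q' then 1 else 0)) = (if q = q' then 1 else 0 :: complex)"
    if "q \<in> J" for q q'
  proof -
    have "(\<Sum>p\<in>J. (if p = q then 1 else 0) * cnj (if p = q' then 1 else 0))
        = (\<Sum>p\<in>J. if p = q then (if q = q' then 1 else 0 :: complex) else 0)"
      by (intro sum.cong) auto
    then show ?thesis using J that by simp
  qed
  moreover have "(\<Sum>q\<in>J. (if p = q then 1 else 0) * cnj (if p' = q then 1 else 0)) = (if p = p' then 1 else 0 :: complex)"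
    if "p \<in> J" for p p'
  proof -
    have "(\<Sum>q\<in>J. (if p = q then 1 else 0) * cnj (if p' = q then 1 else 0))
        = (\<Sum>q\<in>J. if p = q then (if p = p' then 1 else 0 :: complex) else 0)"
      by (intro sum.cong) auto
    then show ?thesis using J that by simp
  qed
  ultimately show ?thesis unfolding unitary_matrix_def by blast
qed

text \<open>The square sum of the coefficients \<open>s\<close> is \<open>N ^ 9\<close>:
  \<open>N ^ 3\<close> from completeness in three legs times \<open>N ^ 6\<close> pairs of
  positions. Division by \<open>h\<^sup>2 = N ^ 3\<close> and by \<open>K\<close>, of order
  \<open>N powr (11/2) * (L + 1)\<close>, leaves \<open>sqrt N / (L + 1)\<close>;
  \<open>2400000 = 8 * 300000\<close>.\<close>

lemma C3_ge:
  assumes universe: "inj (f0 :: (nat \<Rightarrow> complex) \<Rightarrow> 'a)" and N: "N > 0" "N\<^sup>2 \<le> n" and L: "N \<le> 2 ^ L"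
  shows "ereal (sqrt (real N) / (2400000 * (real L + 1))) \<le> C3 TYPE('a) n"
proof -
  obtain V :: "nat \<Rightarrow> nat \<Rightarrow> nat \<Rightarrow> complex" where
    unit: "\<And>i. i \<in> {1..N\<^sup>2} \<Longrightarrow> unitary_matrix {..<N} (V i)" and
    orth: "\<And>i i'. i \<in> {1..N\<^sup>2} \<Longrightarrow> i' \<in> {1..N\<^sup>2} \<Longrightarrow>
      (\<Sum>(p, q)\<in>{..<N} \<times> {..<N}. V i p q * cnj (V i' p q)) = (if i = i' then of_nat N else 0)" and
    compl: "\<And>p q p' q'. p < N \<Longrightarrow> q < N \<Longrightarrow> p' < N \<Longrightarrow> q' < N \<Longrightarrow>
      (\<Sum>i=1..N\<^sup>2. V i p q * cnj (V i p' q')) = (if p = p' \<and> q = q' then of_nat N else 0)"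
    using exists_unitary_basis[of N] by blast
  obtain \<psi> \<phi> :: "nat \<times> nat \<times> nat \<Rightarrow> real" where
    signs: "\<And>p. p \<in> cube N \<Longrightarrow> \<bar>\<psi> p\<bar> = 1" "\<And>p. p \<in> cube N \<Longrightarrow> \<bar>\<phi> p\<bar> = 1" and
    bound: "\<And>A B C. hs_norm N A \<le> 1 \<Longrightarrow> hs_norm N B \<le> 1 \<Longrightarrow> hs_norm N C \<le> 1 \<Longrightarrow>
      \<bar>\<Sum>p\<in>cube N. \<psi> p * tens_apply N A B C \<phi> p\<bar> \<le> 300000 * real N * (real L + 1)"
    using random_tensor_bound[OF N(1) L] by blast
  \<comment> \<open>\<open>h\<close> has two roles: it is the Hilbert-Schmidt norm of a unimodular
    combination of the \<open>N\<^sup>2\<close> unitaries, and the Euclidean norm of a sign tensor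
    on the \<open>N ^ 3\<close> points of the cube.\<close>
  define h where "h = real N * sqrt (real N)"
  define K where "K = 8 * (300000 * real N * (real L + 1)) * h ^ 3"
  have h: "h > 0" "h\<^sup>2 = real N ^ 3" using N by (simp_all add: h_def power_mult_distrib power3_eq_cube power2_eq_square)
  have K: "K > 0" using h N by (simp add: K_def)
  define s where "s i j k = (\<Sum>p\<in>cube N. \<Sum>q\<in>cube N. \<psi> p * \<phi> q * kron3 (V i) (V j) (V k) p q)" for i j k
  have s_pair: "s i j k = (\<Sum>m\<in>cube N \<times> cube N. \<psi> (fst m) * \<phi> (snd m) * kron3 (V i) (V j) (V k) (fst m) (snd m))" for i j k
    by (simp add: s_def sum.cartesian_product case_prod_unfold)
  \<comment> \<open>\<open>K\<close> is the bound for the supremum norm of \<open>s\<close>, so that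
    \<open>t\<close> lies in the unit ball. Extension by 0 handles those \<open>n\<close> that are
    not squares.\<close>
  define t where "t i j k = (if i \<le> N\<^sup>2 \<and> j \<le> N\<^sup>2 \<and> k \<le> N\<^sup>2 then s i j k / K else 0)" for i j k
  have restrict: "(\<Sum>i=1..n. \<Sum>j=1..n. \<Sum>k=1..n. t i j k * F i j k)
      = (\<Sum>i=1..N\<^sup>2. \<Sum>j=1..N\<^sup>2. \<Sum>k=1..N\<^sup>2. s i j k / K * F i j k)"
    for F
  proof -
    have cut: "(\<Sum>i=1..n. G i) = (\<Sum>i=1..N\<^sup>2. G i)" if "\<And>i. i > N\<^sup>2 \<Longrightarrow> G i = 0" for G :: "nat \<Rightarrow> complex"
      using N(2) by (intro sum.mono_neutral_right) (auto simp: that not_le)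
    have "(\<Sum>i=1..n. \<Sum>j=1..n. \<Sum>k=1..n. t i j k * F i j k) = (\<Sum>i=1..N\<^sup>2. \<Sum>j=1..n. \<Sum>k=1..n. t i j k * F i j k)"
      by (rule cut) (simp add: t_def)
    also have "\<dots> = (\<Sum>i=1..N\<^sup>2. \<Sum>j=1..N\<^sup>2. \<Sum>k=1..n. t i j k * F i j k)"
      by (intro sum.cong refl cut) (simp add: t_def)
    also have "\<dots> = (\<Sum>i=1..N\<^sup>2. \<Sum>j=1..N\<^sup>2. \<Sum>k=1..N\<^sup>2. t i j k * F i j k)"
      by (intro sum.cong refl cut) (simp add: t_def)
    also have "\<dots> = (\<Sum>i=1..N\<^sup>2. \<Sum>j=1..N\<^sup>2. \<Sum>k=1..N\<^sup>2. s i j k / K * F i j k)"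
      by (intro sum.cong refl) (simp add: t_def)
    finally show ?thesis .
  qed

  have hs_V: "(\<Sum>p<N. \<Sum>q<N. (cmod (\<Sum>i=1..N\<^sup>2. x i * V i p q))\<^sup>2) \<le> h\<^sup>2"
    if x: "\<And>i. i \<in> {1..n} \<Longrightarrow> cmod (x i) = 1" for x
  proof -
    have "complex_of_real (\<Sum>p<N. \<Sum>q<N. (cmod (\<Sum>i=1..N\<^sup>2. x i * V i p q))\<^sup>2)
        = (\<Sum>m\<in>{..<N} \<times> {..<N}. (\<Sum>i\<in>{1..N\<^sup>2}. x i * V i (fst m) (snd m)) * cnj (\<Sum>i\<in>{1..N\<^sup>2}. x i * V i (fst m) (snd m)))"
      by (simp only: sum.cartesian_product case_prod_unfold of_real_sum complex_norm_square)
    also have "\<dots> = of_nat N * (\<Sum>i\<in>{1..N\<^sup>2}. x i * cnj (x i))"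
      by (rule sum_Parseval) (use orth in \<open>auto simp: case_prod_unfold\<close>)
    also have "(\<Sum>i\<in>{1..N\<^sup>2}. x i * cnj (x i)) = (\<Sum>i\<in>{1..N\<^sup>2}. 1)"
      using N(2) by (intro sum.cong refl) (simp add: x flip: complex_norm_square)
    also have "of_nat N * (\<Sum>i\<in>{1..N\<^sup>2}. 1) = complex_of_real (real N ^ 3)"
      by (simp add: power3_eq_cube power2_eq_square)
    finally show ?thesis unfolding of_real_eq_iff h(2) by simp
  qed
  have "vee_norm n t \<le> 1"
    unfolding vee_norm_def
  proof (rule Sup_least, clarify)
    fix x y z :: "nat \<Rightarrow> complex"
    assume x: "\<forall>i\<in>{1..n}. cmod (x i) = 1" and y: "\<forall>j\<in>{1..n}. cmod (y j) = 1" and z: "\<forall>k\<in>{1..n}. cmod (z k) = 1"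
    \<comment> \<open>The scalars are absorbed into matrices: evaluating \<open>t\<close> at
      \<open>x, y, z\<close> amounts to pairing \<open>\<psi>\<close> with
      \<open>(A x \<otimes> A y \<otimes> A z) \<phi>\<close>, divided by \<open>K\<close>.\<close>
    define A where "A x p q = (\<Sum>i=1..N\<^sup>2. x i * V i p q)" for x p q
    have "(\<Sum>i=1..n. \<Sum>j=1..n. \<Sum>k=1..n. t i j k * x i * y j * z k)
        = (\<Sum>i=1..N\<^sup>2. \<Sum>j=1..N\<^sup>2. \<Sum>k=1..N\<^sup>2. s i j k / K * (x i * y j * z k))"
      unfolding restrict[symmetric] by (simp add: mult.assoc)
    also have "\<dots> = (\<Sum>i=1..N\<^sup>2. \<Sum>j=1..N\<^sup>2. \<Sum>k=1..N\<^sup>2. \<Sum>m\<in>cube N \<times> cube N.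
        \<psi> (fst m) * \<phi> (snd m) * (x i * y j * z k * kron3 (V i) (V j) (V k) (fst m) (snd m))) / K"
      unfolding s_pair by (simp add: sum_distrib_left sum_distrib_right sum_divide_distrib mult_ac)
    also have "(\<Sum>i=1..N\<^sup>2. \<Sum>j=1..N\<^sup>2. \<Sum>k=1..N\<^sup>2. \<Sum>m\<in>cube N \<times> cube N.
        \<psi> (fst m) * \<phi> (snd m) * (x i * y j * z k * kron3 (V i) (V j) (V k) (fst m) (snd m)))
       = (\<Sum>i=1..N\<^sup>2. \<Sum>m\<in>cube N \<times> cube N. \<Sum>j=1..N\<^sup>2. \<Sum>k=1..N\<^sup>2.
        \<psi> (fst m) * \<phi> (snd m) * (x i * y j * z k * kron3 (V i) (V j) (V k) (fst m) (snd m)))"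
      by (intro sum.cong refl sum_rotate3)
    also have "\<dots> = (\<Sum>m\<in>cube N \<times> cube N. \<Sum>i=1..N\<^sup>2. \<Sum>j=1..N\<^sup>2. \<Sum>k=1..N\<^sup>2.
        \<psi> (fst m) * \<phi> (snd m) * (x i * y j * z k * kron3 (V i) (V j) (V k) (fst m) (snd m)))"
      by (rule sum.swap)
    also have "\<dots> = (\<Sum>m\<in>cube N \<times> cube N. \<psi> (fst m) * \<phi> (snd m) * kron3 (A x) (A y) (A z) (fst m) (snd m))"
      unfolding A_def sum_kron3[symmetric] by (simp add: sum_distrib_left)
    also have "\<dots> = (\<Sum>p\<in>cube N. \<psi> p * tens_apply N (A x) (A y) (A z) (\<lambda>p. complex_of_real (\<phi> p)) p)"
      by (simp add: tens_apply_kron3 sum.cartesian_product' sum_distrib_left mult_ac)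
    finally have eq: "(\<Sum>i=1..n. \<Sum>j=1..n. \<Sum>k=1..n. t i j k * x i * y j * z k)
        = (\<Sum>p\<in>cube N. \<psi> p * tens_apply N (A x) (A y) (A z) (\<lambda>p. complex_of_real (\<phi> p)) p) / K" .
    have "cmod (\<Sum>p\<in>cube N. \<psi> p * tens_apply N (A x) (A y) (A z) (\<lambda>p. complex_of_real (\<phi> p)) p) \<le> K"
      unfolding K_def A_def using x y z
      by (intro complex_trilinear_bound bound h(1) hs_V) auto
    then have "cmod (\<Sum>i=1..n. \<Sum>j=1..n. \<Sum>k=1..n. t i j k * x i * y j * z k) \<le> 1"
      unfolding eq using K by (simp add: norm_divide)
    then show "ereal (cmod (\<Sum>i=1..n. \<Sum>j=1..n. \<Sum>k=1..n. t i j k * x i * y j * z k)) \<le> 1"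
      by (simp add: one_ereal_def)
  qed
  then have C3: "min_norm TYPE('a) n t \<le> C3 TYPE('a) n"
    unfolding C3_def by (intro Sup_upper) auto

  \<comment> \<open>Conjugation turns the matrix coefficient into the conjugate of
    \<open>s i j k\<close>, so that each summand is a squared modulus. Beyond
    \<open>N\<^sup>2\<close> any unitary will do, as \<open>t\<close> vanishes there.\<close>
  define u where "u i = (if i \<le> N\<^sup>2 then (\<lambda>p q. cnj (V i p q)) else (\<lambda>p q. if p = q then 1 else 0))" for i
  have u: "unitary_matrix {..<N} (u i)" if "i \<in> {1..n}" for i
    using that unit[of i] unitary_matrix_cnj unitary_matrix_one by (auto simp: u_def)
  have norm_sign: "L2_set (\<lambda>p. cmod (complex_of_real (\<sigma> p / h))) (cube N) = 1"
    if "\<And>p. p \<in> cube N \<Longrightarrow> \<bar>\<sigma> p\<bar> = 1" for \<sigma>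
  proof -
    have "(\<Sum>p\<in>cube N. (cmod (complex_of_real (\<sigma> p / h)))\<^sup>2) = (\<Sum>p\<in>cube N. 1 / h\<^sup>2)"
      by (intro sum.cong refl) (simp only: norm_of_real abs_divide that power_divide power_one power2_abs)
    also have "\<dots> = 1" using h N by (simp add: card_cube)
    finally show ?thesis by (simp only: L2_set_def real_sqrt_one)
  qed
  \<comment> \<open>Enumerating the triples lets the same injection \<open>f0\<close> encode the
    vectors of the tensor product; surjectivity of \<open>from_nat\<close> keeps it
    injective.\<close>
  define g0 where "g0 v = f0 (\<lambda>m. v (from_nat m :: nat \<times> nat \<times> nat))" for v :: "nat \<times> nat \<times> nat \<Rightarrow> complex"
  have g0: "inj g0"
  proof (rule injI)
    fix v v' assume "g0 v = g0 v'"
    then have "(\<lambda>m. v (from_nat m)) = (\<lambda>m. v' (from_nat m))" unfolding g0_def by (rule injD[OF universe])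
    then show "v = v'" by (metis ext from_nat_to_nat)
  qed
  have "(\<Sum>i=1..n. \<Sum>j=1..n. \<Sum>k=1..n. t i j k *
      (\<Sum>p\<in>cube N. \<Sum>q\<in>cube N. complex_of_real (\<psi> p / h) * kron3 (u i) (u j) (u k) p q * complex_of_real (\<phi> q / h)))
     = (\<Sum>i=1..N\<^sup>2. \<Sum>j=1..N\<^sup>2. \<Sum>k=1..N\<^sup>2. s i j k / K * (cnj (s i j k) / h\<^sup>2))"
  proof -
    have "(\<Sum>p\<in>cube N. \<Sum>q\<in>cube N. complex_of_real (\<psi> p / h) * kron3 (u i) (u j) (u k) p q * complex_of_real (\<phi> q / h))
        = cnj (s i j k) / h\<^sup>2" if "i \<in> {1..N\<^sup>2}" "j \<in> {1..N\<^sup>2}" "k \<in> {1..N\<^sup>2}" for i j k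
    proof -
      have "kron3 (u i) (u j) (u k) p q = cnj (kron3 (V i) (V j) (V k) p q)" for p q
        using that by (cases p; cases q) (simp add: kron3_def u_def)
      then show ?thesis
        by (simp add: s_def sum_divide_distrib power2_eq_square mult_ac)
    qed
    then show ?thesis unfolding restrict by (intro sum.cong refl) simp
  qed
  also have "\<dots> = (\<Sum>(i, j, k)\<in>{1..N\<^sup>2} \<times> {1..N\<^sup>2} \<times> {1..N\<^sup>2}. s i j k * cnj (s i j k)) / (K * h\<^sup>2)"
    by (simp add: sum.cartesian_product sum_divide_distrib case_prod_unfold)
  also have "(\<Sum>(i, j, k)\<in>{1..N\<^sup>2} \<times> {1..N\<^sup>2} \<times> {1..N\<^sup>2}. s i j k * cnj (s i j k)) = complex_of_real (real N ^ 9)"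
  proof -
    \<comment> \<open>The threefold tensor products inherit completeness leg by leg, with constant
      \<open>N ^ 3\<close>.\<close>
    define w where "w = (\<lambda>(i, j, k) (p, q). kron3 (V i) (V j) (V k) p q)"
    have w: "(\<Sum>m\<in>{1..N\<^sup>2} \<times> {1..N\<^sup>2} \<times> {1..N\<^sup>2}. w m a * cnj (w m b)) = (if a = b then of_nat N ^ 3 else 0)"
      if ab: "a \<in> cube N \<times> cube N" "b \<in> cube N \<times> cube N" for a b
    proof -
      obtain p1 p2 p3 q1 q2 q3 where a: "a = ((p1, p2, p3), (q1, q2, q3))" by (metis surj_pair)
      obtain p1' p2' p3' q1' q2' q3' where b: "b = ((p1', p2', p3'), (q1', q2', q3'))" by (metis surj_pair)
      have lt: "p1 < N" "p2 < N" "p3 < N" "q1 < N" "q2 < N" "q3 < N"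
        "p1' < N" "p2' < N" "p3' < N" "q1' < N" "q2' < N" "q3' < N"
        using ab by (auto simp: a b cube_def)
      have "(\<Sum>m\<in>{1..N\<^sup>2} \<times> {1..N\<^sup>2} \<times> {1..N\<^sup>2}. w m a * cnj (w m b))
          = (\<Sum>i=1..N\<^sup>2. \<Sum>j=1..N\<^sup>2. \<Sum>k=1..N\<^sup>2. (V i p1 q1 * cnj (V i p1' q1')) *
              (V j p2 q2 * cnj (V j p2' q2')) * (V k p3 q3 * cnj (V k p3' q3')))"
        by (simp add: sum.cartesian_product' w_def a b kron3_def mult_ac)
      also have "\<dots> = (\<Sum>i=1..N\<^sup>2. V i p1 q1 * cnj (V i p1' q1')) *
          (\<Sum>j=1..N\<^sup>2. V j p2 q2 * cnj (V j p2' q2')) * (\<Sum>k=1..N\<^sup>2. V k p3 q3 * cnj (V k p3' q3'))"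
        by (simp flip: sum_distrib_left sum_distrib_right)
      also have "\<dots> = (if a = b then of_nat N ^ 3 else 0)"
        by (simp only: compl lt) (auto simp: a b power3_eq_cube)
      finally show ?thesis .
    qed
    have s_eq: "s i j k = (\<Sum>x\<in>cube N \<times> cube N. of_real (\<psi> (fst x) * \<phi> (snd x)) * w (i, j, k) x)" for i j k
      by (simp add: s_pair w_def case_prod_unfold)
    have "(\<Sum>(i, j, k)\<in>{1..N\<^sup>2} \<times> {1..N\<^sup>2} \<times> {1..N\<^sup>2}. s i j k * cnj (s i j k))
        = (\<Sum>m\<in>{1..N\<^sup>2} \<times> {1..N\<^sup>2} \<times> {1..N\<^sup>2}. (\<Sum>x\<in>cube N \<times> cube N. of_real (\<psi> (fst x) * \<phi> (snd x)) * w m x)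
          * cnj (\<Sum>x\<in>cube N \<times> cube N. of_real (\<psi> (fst x) * \<phi> (snd x)) * w m x))"
      unfolding s_eq by (simp add: case_prod_unfold)
    also have "\<dots> = of_nat N ^ 3 * (\<Sum>x\<in>cube N \<times> cube N. of_real (\<psi> (fst x) * \<phi> (snd x)) * cnj (of_real (\<psi> (fst x) * \<phi> (snd x))))"
      by (rule sum_Parseval[OF _ w]) auto
    also have "(\<Sum>x\<in>cube N \<times> cube N. of_real (\<psi> (fst x) * \<phi> (snd x)) * cnj (of_real (\<psi> (fst x) * \<phi> (snd x))))
        = (\<Sum>x\<in>cube N \<times> cube N. 1 :: complex)"
    proof (intro sum.cong refl)
      fix x assume x: "x \<in> cube N \<times> cube N"
      have "\<bar>\<psi> (fst x) * \<phi> (snd x)\<bar> = 1" using x signs by (auto simp: abs_mult)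
      then have "(\<psi> (fst x) * \<phi> (snd x)) * (\<psi> (fst x) * \<phi> (snd x)) = 1"
        by (metis abs_mult_self_eq mult.right_neutral)
      then show "of_real (\<psi> (fst x) * \<phi> (snd x)) * cnj (of_real (\<psi> (fst x) * \<phi> (snd x))) = (1 :: complex)"
        by (metis complex_cnj_complex_of_real of_real_1 of_real_mult)
    qed
    also have "of_nat N ^ 3 * (\<Sum>x\<in>cube N \<times> cube N. 1 :: complex) = complex_of_real (real N ^ 9)"
      by (simp add: card_cartesian_product card_cube flip: power_add)
    finally show ?thesis .
  qed
  also have "cmod (complex_of_real (real N ^ 9) / (K * h\<^sup>2)) = real N ^ 9 / (K * h\<^sup>2)"
    using K h by (simp add: norm_divide norm_mult norm_power)
  also have "\<dots> = sqrt (real N) / (2400000 * (real L + 1))"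
  proof -
    have "K * h\<^sup>2 = 2400000 * (real L + 1) * (real N * h\<^sup>2 * h\<^sup>2 * h)"
      by (simp add: K_def power3_eq_cube power2_eq_square)
    also have "real N * h\<^sup>2 * h\<^sup>2 * h = real N ^ 8 * sqrt (real N)"
      unfolding h(2) by (simp add: h_def flip: power_add) (simp add: eval_nat_numeral)
    finally have "K * h\<^sup>2 = 2400000 * (real L + 1) * (real N ^ 8 * sqrt (real N))" .
    moreover have "real N ^ 9 = real N ^ 8 * sqrt (real N) * sqrt (real N)"
      by (simp add: eval_nat_numeral)
    ultimately show ?thesis using N by simp
  qed
  finally have eq: "cmod (\<Sum>i=1..n. \<Sum>j=1..n. \<Sum>k=1..n. t i j k *
      (\<Sum>p\<in>cube N. \<Sum>q\<in>cube N. complex_of_real (\<psi> p / h) * kron3 (u i) (u j) (u k) p q * complex_of_real (\<phi> q / h)))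
     = sqrt (real N) / (2400000 * (real L + 1))" .
  have "ereal (sqrt (real N) / (2400000 * (real L + 1))) \<le> min_norm TYPE('a) n t"
    unfolding eq[symmetric]
    by (rule min_norm_ge[OF universe g0 u norm_sign[OF signs(2)] norm_sign[OF signs(1)]])
  then show ?thesis using C3 by (rule order_trans)
qed

theorem theorem1p5:
  assumes universe: "\<exists>f :: (nat \<Rightarrow> complex) \<Rightarrow> 'a. inj f"
  shows "\<exists>C'>0. \<forall>n\<ge>2.
    ereal (C' * real n powr (1/4) * ln (real n) powr (-3/2)) \<le> C3 TYPE('a) n"
proof -
  obtain f0 :: "(nat \<Rightarrow> complex) \<Rightarrow> 'a" where f0: "inj f0" using universe by blast
  have "ereal (1 / 48000000 * real n powr (1/4) * ln (real n) powr (-3/2)) \<le> C3 TYPE('a) n" if n: "n \<ge> 2" for n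
  proof -
    \<comment> \<open>The largest \<open>N\<close> for which \<open>n\<close> indices accommodate
      all \<open>N\<^sup>2\<close> Weyl matrices.\<close>
    define N where "N = nat \<lfloor>sqrt (real n)\<rfloor>"
    define l where "l = ln (real n)"
    have sq1: "sqrt (real n) \<ge> 1" using n by simp
    have N: "real N \<le> sqrt (real n)" "sqrt (real n) < real N + 1" "N > 0"
      unfolding N_def using sq1 by (simp_all; linarith)+
    have "(real N)\<^sup>2 \<le> (sqrt (real n))\<^sup>2" using N by (intro power_mono) auto
    then have "real (N\<^sup>2) \<le> real n" by simp
    then have Nn: "N\<^sup>2 \<le> n" by (simp only: of_nat_le_iff)
    define L where "L = nat \<lceil>log 2 (real N)\<rceil>"
    have log_nonneg: "0 \<le> log 2 (real N)" using N by simp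
    have "real N = 2 powr (log 2 (real N))" using N by simp
    also have "\<dots> \<le> 2 powr (real L)" unfolding L_def by (intro powr_mono) linarith+
    finally have "real N \<le> real (2 ^ L)" by (simp add: powr_realpow)
    then have NL: "N \<le> 2 ^ L" by (simp only: of_nat_le_iff)
    have ln2: "ln 2 \<ge> (1/2 :: real)" using ln2_ge_two_thirds by simp
    have "ln 2 \<le> ln (real n)" using n by (subst ln_le_cancel_iff) auto
    then have l: "l \<ge> 1/2" using ln2 by (simp add: l_def)
    \<comment> \<open>\<open>L\<close> is at most \<open>l + 1\<close>, and
      \<open>l \<ge> 1/2\<close> absorbs the remaining 2 into \<open>4 * l\<close>.\<close>
    have L: "real L + 1 \<le> 5 * l"
    proof -
      have "ln (real N) \<le> ln (sqrt (real n))" using N n by simp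
      also have "\<dots> = l / 2" using n by (simp add: ln_sqrt l_def)
      finally have "ln (real N) \<le> l / 2" .
      moreover have "log 2 (real N) * ln 2 = ln (real N)" by (simp add: log_def)
      moreover have "log 2 (real N) * (1/2) \<le> log 2 (real N) * ln 2" using log_nonneg ln2 by (intro mult_left_mono) auto
      ultimately have "log 2 (real N) \<le> l" by linarith
      moreover have "real L \<le> log 2 (real N) + 1" unfolding L_def using log_nonneg by linarith
      ultimately show ?thesis using l by linarith
    qed
    have root: "real n powr (1/4) = sqrt (sqrt (real n))"
      by (simp add: powr_powr flip: powr_half_sqrt)
    have "sqrt (real n) \<le> 4 * real N" using N by simp
    then have "sqrt (sqrt (real n)) \<le> sqrt (4 * real N)" by (rule real_sqrt_le_mono)
    then have r: "real n powr (1/4) \<le> 2 * sqrt (real N)" by (simp add: root real_sqrt_mult)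
    \<comment> \<open>Here a factor \<open>1 / sqrt l\<close> of the estimate is given away;
      \<open>n \<ge> 2\<close> enters through \<open>l \<ge> 1/2\<close>, which bounds this factor
      by 2.\<close>
    have p: "l powr (-3/2) \<le> 2 / l"
    proof -
      have "l powr (-3/2) = l powr (-1) * l powr (-1/2)" by (simp only: powr_add[symmetric]) simp
      also have "l powr (-1/2) = 1 / sqrt l" using l by (simp add: powr_minus_divide powr_half_sqrt)
      also have "1 / sqrt l \<le> 2"
      proof -
        have "sqrt (1/4) \<le> sqrt l" using l by (intro real_sqrt_le_mono) simp
        then show ?thesis using l by (simp add: real_sqrt_divide field_simps)
      qed
      finally show ?thesis using l by (simp add: powr_minus_divide mult_left_mono field_simps)
    qed
    \<comment> \<open>\<open>48000000 = 2400000 * 5 * 2 * 2\<close> collects the constant of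
      \<open>C3_ge\<close>, the bound on \<open>L\<close> and the two factors 2 from
      \<open>r\<close> and \<open>p\<close>.\<close>
    have "1 / 48000000 * real n powr (1/4) * l powr (-3/2) \<le> 1 / 48000000 * (2 * sqrt (real N)) * (2 / l)"
      using r p by (intro mult_mono) auto
    also have "\<dots> = sqrt (real N) / (2400000 * (5 * l))" by simp
    also have "\<dots> \<le> sqrt (real N) / (2400000 * (real L + 1))"
      using L l by (intro divide_left_mono) auto
    finally have "ereal (1 / 48000000 * real n powr (1/4) * l powr (-3/2)) \<le> ereal (sqrt (real N) / (2400000 * (real L + 1)))"
      by simp
    also have "\<dots> \<le> C3 TYPE('a) n" by (rule C3_ge[OF f0 N(3) Nn NL])
    finally show ?thesis by (simp add: l_def)
  qed
  then show ?thesis by (intro exI[of _ "1 / 48000000"]) auto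
qed

end
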